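(* Let $a,b,c,z$ be independent (unrelated) parameters. (1) For any integers $k,l,m$ there are unique rational functions $\mathbf{P}(k,l,m),\mathbf{Q}(k,l,m)\in\mathbf{C}(a,b,c,z)$ such that $$\mathbf{F}\!\left({a+k,\,b+l \atop c+m}\right)=\mathbf{P}(k,l,m)\,\mathbf{F}\!\left({a,\,b\atop c}\right)+\mathbf{Q}(k,l,m)\,\mathbf{F}\!\left({a+1,\,b\atop c}\right).$$ (2) These functions satisfy the same contiguous relations as $\mathbf{F}\!\left({a,\,b\atop c}\right)$. That is, if $\alpha_n,\beta_n,\gamma_n$ ($n=1,2,3$) are integers and $f_1,f_2,f_3\in\mathbf{C}(a,b,c,z)$ satisfy $$\sum_{n=1}^3 f_n\,\mathbf{F}\!\left({a+\alpha_n,\,b+\beta_n\atop c+\gamma_n}\right)=0,$$ then for all integers $k,l,m$ $$\sum_{n=1}^3\left(\mathcal{S}_a^k\mathcal{S}_b^l\mathcal{S}_c^m f_n\right)\mathbf{P}(k+\alpha_n,\,l+\beta_n,\,m+\gamma_n)=0$$ and $$\sum_{n=1}^3\left(\mathcal{S}_a^k\mathcal{S}_b^l\mathcal{S}_c^m f_n\right)\mathbf{Q}(k+\alpha_n,\,l+\beta_n,\,m+\gamma_n)=0.$$ (3) Moreover, the following hold for all integers $k,l,m,k',l',m'$: (a) $\mathbf{P}(0,0,0)=1$, $\mathbf{Q}(0,0,0)=0$, $\mathbf{P}(1,0,0)=0$, $\mathbf{Q}(1,0,0)=1$. (b) $$\mathbf{P}(k,l,m)=\frac{c-a-1}{(a+1)(1-z)}\;\mathcal{S}_a\mathbf{Q}(k-1,l,m).$$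 (c) $$\mathbf{Q}(k+k',l+l',m+m')=\left(\mathcal{S}_a^k\mathcal{S}_b^l\mathcal{S}_c^m\,\mathbf{Q}(k',l',m')\right)\mathbf{Q}(k+1,l,m)+\left(\mathcal{S}_a^{k+1}\mathcal{S}_b^l\mathcal{S}_c^m\left[\frac{c-a}{a(1-z)}\,\mathbf{Q}(k'-1,l',m')\right]\right)\mathbf{Q}(k,l,m).$$ (d) $$\left|\begin{array}{cc}\mathbf{P}(k,l,m)&\mathbf{P}(k',l',m')\\ \mathbf{Q}(k,l,m)&\mathbf{Q}(k',l',m')\end{array}\right|=\frac{(c)_m\,(c)_m\,z^{-m}(z-1)^{m-k-l}}{(a+1)_k\,(b)_l\,(c-a)_{m-k}\,(c-b)_{m-l}}\;\mathcal{S}_a^k\mathcal{S}_b^l\mathcal{S}_c^m\,\mathbf{Q}(k'-k,\,l'-l,\,m'-m).$$ (e) $$\mathbf{Q}(-k,-l,-m)=\frac{(-1)^{m+1}\,(-a)_k\,(1-b)_l\,z^m(1-z)^{k+l-m}}{(1-c)_m\,(1-c)_m\,(c-a)_{k-m}\,(c-b)_{l-m}}\;\mathcal{S}_a^{-k}\mathcal{S}_b^{-l}\mathcal{S}_c^{-m}\,\mathbf{Q}(k,l,m).$$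
   Context: $\mathbf{F}\!\left({a,\,b\atop c}\right)={}_2F_1\!\left({a,\,b\atop c}\Big|\,z\right)=1+\frac{ab}{c\cdot 1}z+\frac{a(a+1)b(b+1)}{c(c+1)\cdot 1\cdot 2}z^2+\cdots$ denotes the Gauss hypergeometric series with argument $z$; $a,b,c,z$ are treated as independent variables, so $\mathbf{F}$ may be regarded as a power series in $z$ with coefficients in $\mathbf{C}(a,b,c)$. Shift operators: $\mathcal{S}_a,\mathcal{S}_b,\mathcal{S}_c$ are the automorphisms of $\mathbf{C}(a,b,c,z)$ given by the substitutions $a\mapsto a+1$, $b\mapsto b+1$, $c\mapsto c+1$ respectively (the other variables fixed); negative powers denote inverse shifts. Pochhammer symbol: for an integer $k$ (of any sign), $(x)_k=\Gamma(x+k)/\Gamma(x)$, understood as a rational function of $x$; for positive $k$ it equals $x(x+1)\cdots(x+k-1)$, $(x)_0=1$, and $(x)_{-k}=1/\big((x-1)(x-2)\cdots(x-k)\big)$ for positive $k$. *)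

theory Defs
  imports
    "HOL-Computational_Algebra.Computational_Algebra"
begin

text \<open>
  The field of rational functions \<open>\<complex>(a,b,c)\<close> is the fraction field of \<open>\<complex>[a][b][c]\<close>
  (innermost variable \<open>a\<close>, outermost variable \<open>c\<close>), and \<open>\<complex>(a,b,c,z)\<close> is \<open>\<complex>(a,b,c)(z)\<close>.
\<close>

type_synonym Cabc = "complex poly poly poly fract"
type_synonym Cabcz = "Cabc poly fract"

instance fract :: ("{idom, ring_char_0}") field_char_0
proof
  show "inj (of_nat :: nat \<Rightarrow> 'a fract)"
    by (rule injI) (simp add: of_nat_fract eq_fract)
qed

text \<open>
  Extension of an injective ring homomorphism \<open>h\<close> from an integral domain into a field
  to the fraction field; for such \<open>h\<close> the chosen value is unique, see
  \<open>fract_lift_Fract\<close> below.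
\<close>

definition fract_lift :: "('r::idom \<Rightarrow> 'f::field) \<Rightarrow> 'r fract \<Rightarrow> 'f" where
  "fract_lift h x = (SOME y. \<exists>p q. q \<noteq> 0 \<and> x = Fract p q \<and> y = h p / h q)"

lemma fract_lift_Fract:
  fixes h :: "'r::idom \<Rightarrow> 'f::field"
  assumes mult: "\<And>p q. h (p * q) = h p * h q"
    and nonzero: "\<And>p. p \<noteq> 0 \<Longrightarrow> h p \<noteq> 0"
    and q: "q \<noteq> 0"
  shows "fract_lift h (Fract p q) = h p / h q"
  unfolding fract_lift_def
proof (rule some_equality)
  show "\<exists>p' q'. q' \<noteq> 0 \<and> Fract p q = Fract p' q' \<and> h p / h q = h p' / h q'"
    using q by blast
next
  fix y
  assume "\<exists>p' q'. q' \<noteq> 0 \<and> Fract p q = Fract p' q' \<and> y = h p' / h q'"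
  then obtain p' q' where q': "q' \<noteq> 0" and eq: "Fract p q = Fract p' q'" and y: "y = h p' / h q'"
    by blast
  have "p * q' = p' * q"
    using eq q q' by (simp add: eq_fract)
  then have "h p * h q' = h p' * h q"
    by (metis mult)
  then show "y = h p / h q"
    using nonzero[OF q] nonzero[OF q'] y by (simp add: frac_eq_eq)
qed


subsection \<open>Variables\<close>

definition par_a :: Cabc where "par_a = to_fract [:[:[:0, 1:]:]:]"
definition par_b :: Cabc where "par_b = to_fract [:[:0, 1:]:]"
definition par_c :: Cabc where "par_c = to_fract [:0, 1:]"

definition var_a :: Cabcz (\<open>\<^bold>a\<close>) where "\<^bold>a = to_fract [:par_a:]"
definition var_b :: Cabcz (\<open>\<^bold>b\<close>) where "\<^bold>b = to_fract [:par_b:]"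
definition var_c :: Cabcz (\<open>\<^bold>c\<close>) where "\<^bold>c = to_fract [:par_c:]"
definition var_z :: Cabcz (\<open>\<^bold>z\<close>) where "\<^bold>z = to_fract [:0, 1:]"


subsection \<open>The hypergeometric series and rational functions in a common field\<close>

text \<open>
  Both the power series in \<open>z\<close> over \<open>\<complex>(a,b,c)\<close> and the rational functions in
  \<open>\<complex>(a,b,c,z)\<close> live in the field of formal Laurent series in \<open>z\<close> over \<open>\<complex>(a,b,c)\<close>; a
  rational function is sent to its Laurent expansion at \<open>z = 0\<close>.
\<close>

definition laurent :: "Cabcz \<Rightarrow> Cabc fls" where
  "laurent = fract_lift (\<lambda>p. fps_to_fls (fps_of_poly p))"

text \<open>
  \<open>hypF k l m\<close> is the Gauss series with parameters \<open>a + k\<close>, \<open>b + l\<close>; \<open>c + m\<close>. In the library's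
  \<open>fps_hypergeo\<close>, the last argument \<open>1\<close> means that the argument of the series is \<open>1 * z\<close>.
\<close>

definition hypF :: "int \<Rightarrow> int \<Rightarrow> int \<Rightarrow> Cabc fls" (\<open>\<^bold>F\<close>) where
  "\<^bold>F k l m =
     fps_to_fls (fps_hypergeo [par_a + of_int k, par_b + of_int l] [par_c + of_int m] 1)"


subsection \<open>Shift operators\<close>

definition shift_lift ::
    "(complex poly poly poly \<Rightarrow> complex poly poly poly) \<Rightarrow> Cabcz \<Rightarrow> Cabcz" where
  "shift_lift \<sigma> =
     fract_lift (\<lambda>p. to_fract (map_poly (fract_lift (\<lambda>q. to_fract (\<sigma> q))) p))"

definition shift_a :: "Cabcz \<Rightarrow> Cabcz" (\<open>S\<^sub>a\<close>) where
  "S\<^sub>a = shift_lift (map_poly (map_poly (\<lambda>p. pcompose p [:1, 1:])))"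

definition shift_b :: "Cabcz \<Rightarrow> Cabcz" (\<open>S\<^sub>b\<close>) where
  "S\<^sub>b = shift_lift (map_poly (\<lambda>p. pcompose p [:1, 1:]))"

definition shift_c :: "Cabcz \<Rightarrow> Cabcz" (\<open>S\<^sub>c\<close>) where
  "S\<^sub>c = shift_lift (\<lambda>p. pcompose p [:1, 1:])"

text \<open>Integer iterates of a bijection.\<close>

definition int_iter :: "('x \<Rightarrow> 'x) \<Rightarrow> int \<Rightarrow> 'x \<Rightarrow> 'x" where
  "int_iter f k = (if k \<ge> 0 then f ^^ nat k else inv f ^^ nat (- k))"

definition shift :: "int \<Rightarrow> int \<Rightarrow> int \<Rightarrow> Cabcz \<Rightarrow> Cabcz" (\<open>\<S>\<close>) where
  "\<S> k l m x = int_iter S\<^sub>a k (int_iter S\<^sub>b l (int_iter S\<^sub>c m x))"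


subsection \<open>Pochhammer symbols with integer index\<close>

definition pochhammer_int :: "'f::field \<Rightarrow> int \<Rightarrow> 'f" where
  "pochhammer_int x k =
     (if k \<ge> 0 then pochhammer x (nat k) else 1 / (\<Prod>i=1..nat (- k). x - of_nat i))"


subsection \<open>The shifts are field automorphisms\<close>

text \<open>
  In particular the inverse in \<open>int_iter\<close> is a genuine two-sided inverse.
\<close>

definition ring_embedding :: "('r::comm_ring_1 \<Rightarrow> 's::comm_ring_1) \<Rightarrow> bool" where
  "ring_embedding h \<longleftrightarrow>
     (\<forall>p q. h (p + q) = h p + h q) \<and> (\<forall>p q. h (p * q) = h p * h q) \<and> h 1 = 1 \<and> inj h"

lemma ring_embeddingD:
  assumes "ring_embedding h"
  shows "h (p + q) = h p + h q" "h (p * q) = h p * h q" "h 1 = 1" "h 0 = 0"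
    "h p = 0 \<longleftrightarrow> p = 0"
proof -
  show add: "h (p + q) = h p + h q" for p q
    using assms by (simp add: ring_embedding_def)
  show "h (p * q) = h p * h q" "h 1 = 1"
    using assms by (simp_all add: ring_embedding_def)
  show zero: "h 0 = 0"
    using add[of 0 0] by simp
  show "h p = 0 \<longleftrightarrow> p = 0"
    using assms zero by (metis ring_embedding_def injD)
qed

lemma ring_embeddingI:
  assumes add: "\<And>p q. h (p + q) = h p + h q" and mult: "\<And>p q. h (p * q) = h p * h q"
    and one: "h 1 = 1" and nz: "\<And>p. h p = 0 \<Longrightarrow> p = 0"
  shows "ring_embedding h"
proof -
  have "inj h"
  proof (rule injI)
    fix x y assume "h x = h y"
    moreover have "h x = h (x - y) + h y"
      using add[of "x - y" y] by simp
    ultimately have "h (x - y) = 0" by simp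
    then show "x = y" using nz by fastforce
  qed
  then show ?thesis
    using add mult one by (simp add: ring_embedding_def)
qed

lemma fract_lift_embedding:
  fixes h :: "'r::idom \<Rightarrow> 'f::field"
  assumes "ring_embedding h" "q \<noteq> 0"
  shows "fract_lift h (Fract p q) = h p / h q"
  using assms(2) ring_embeddingD(2,5)[OF assms(1)] by (intro fract_lift_Fract) auto

lemma fract_lift_to_fract:
  fixes h :: "'r::idom \<Rightarrow> 'f::field"
  assumes "ring_embedding h"
  shows "fract_lift h (to_fract p) = h p"
  using fract_lift_embedding[OF assms, of 1 p] by (simp add: to_fract_def ring_embeddingD[OF assms])

lemma ring_embedding_fract_lift:
  fixes h :: "'r::idom \<Rightarrow> 'f::field"
  assumes h: "ring_embedding h"
  shows "ring_embedding (fract_lift h)"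
proof (rule ring_embeddingI)
  fix x y :: "'r fract"
  obtain p q where x: "x = Fract p q" "q \<noteq> 0" by (cases x)
  obtain p' q' where y: "y = Fract p' q'" "q' \<noteq> 0" by (cases y)
  note [simp] = x y fract_lift_embedding[OF h] ring_embeddingD[OF h]
  show "fract_lift h (x + y) = fract_lift h x + fract_lift h y"
    by (simp add: add_frac_eq)
  show "fract_lift h (x * y) = fract_lift h x * fract_lift h y"
    by simp
  show "fract_lift h x = 0 \<Longrightarrow> x = 0"
    by (simp add: fract_collapse)
next
  show "fract_lift h 1 = 1"
    by (simp add: One_fract_def fract_lift_embedding[OF h] ring_embeddingD[OF h])
qed

lemma ring_embedding_comp:
  assumes "ring_embedding f" "ring_embedding g"
  shows "ring_embedding (\<lambda>x. f (g x))"
  by (rule ring_embeddingI)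
    (simp_all add: ring_embeddingD[OF assms(1)] ring_embeddingD[OF assms(2)])

lemma ring_embedding_to_fract: "ring_embedding (to_fract :: 'r::idom \<Rightarrow> 'r fract)"
  by (rule ring_embeddingI) auto

lemma ring_embedding_map_poly:
  assumes h: "ring_embedding h"
  shows "ring_embedding (map_poly h)"
proof (rule ring_embeddingI)
  have sum: "h (sum f A) = (\<Sum>i\<in>A. h (f i))" for f and A :: "nat set"
    by (induction A rule: infinite_finite_induct) (simp_all add: ring_embeddingD[OF h])
  show "map_poly h (p + q) = map_poly h p + map_poly h q" for p q
    by (intro poly_eqI) (simp add: coeff_map_poly ring_embeddingD[OF h])
  show "map_poly h (p * q) = map_poly h p * map_poly h q" for p q
    by (intro poly_eqI) (simp add: coeff_map_poly coeff_mult sum ring_embeddingD[OF h])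
  show "map_poly h 1 = 1"
    by (simp add: ring_embeddingD[OF h])
  show "map_poly h p = 0 \<Longrightarrow> p = 0" for p
    by (simp add: poly_eq_iff coeff_map_poly ring_embeddingD[OF h])
qed

lemma ring_embedding_pcompose:
  "ring_embedding (\<lambda>p :: 'r::idom poly. pcompose p [:r, 1:])"
  by (rule ring_embeddingI) (auto simp: pcompose_add pcompose_mult pcompose_1 pcompose_eq_0_iff)

lemma fract_lift_fract_lift:
  fixes f :: "'s::idom \<Rightarrow> 'f::field" and g :: "'r::idom \<Rightarrow> 's"
  assumes f: "ring_embedding f" and g: "ring_embedding g"
  shows "fract_lift f (fract_lift (\<lambda>p. to_fract (g p)) x) = fract_lift (\<lambda>p. f (g p)) x"
proof -
  obtain p q where x: "x = Fract p q" "q \<noteq> 0" by (cases x)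
  have "fract_lift (\<lambda>p. to_fract (g p)) x = Fract (g p) (g q)"
    unfolding x(1) fract_lift_embedding[OF ring_embedding_comp[OF ring_embedding_to_fract g] x(2)]
    by (simp add: Fract_conv_to_fract)
  then show ?thesis
    using x by (simp add: fract_lift_embedding[OF f] fract_lift_embedding[OF ring_embedding_comp[OF f g]]
        ring_embeddingD[OF g])
qed

lemma fract_lift_to_fract_id: "fract_lift to_fract x = x"
proof -
  obtain p q where x: "x = Fract p q" "q \<noteq> 0" by (cases x)
  show ?thesis
    unfolding x(1) fract_lift_embedding[OF ring_embedding_to_fract x(2)]
    by (simp add: Fract_conv_to_fract)
qed

lemma ring_embedding_shift_lift:
  assumes "ring_embedding \<sigma>"
  shows "ring_embedding (shift_lift \<sigma>)"
  unfolding shift_lift_def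
  by (rule ring_embedding_fract_lift[OF ring_embedding_comp[OF ring_embedding_to_fract
        ring_embedding_map_poly[OF ring_embedding_fract_lift[OF ring_embedding_comp[OF
            ring_embedding_to_fract assms]]]]])

lemma shift_lift_inverse:
  assumes s: "ring_embedding \<sigma>" and t: "ring_embedding \<tau>" and inv: "\<And>p. \<sigma> (\<tau> p) = p"
  shows "shift_lift \<sigma> (shift_lift \<tau> x) = x"
proof -
  let ?\<sigma> = "fract_lift (\<lambda>q. to_fract (\<sigma> q))" and ?\<tau> = "fract_lift (\<lambda>q. to_fract (\<tau> q))"
  have s': "ring_embedding ?\<sigma>" and t': "ring_embedding ?\<tau>"
    by (rule ring_embedding_fract_lift, rule ring_embedding_comp[OF ring_embedding_to_fract],
        rule s t)+
  have "?\<sigma> (?\<tau> y) = y" for y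
    by (simp add: fract_lift_fract_lift[OF ring_embedding_comp[OF ring_embedding_to_fract s] t] inv
        fract_lift_to_fract_id)
  then have "map_poly ?\<sigma> (map_poly ?\<tau> p) = p" for p
    by (intro poly_eqI) (simp add: coeff_map_poly ring_embeddingD[OF s'] ring_embeddingD[OF t'])
  then show ?thesis
    unfolding shift_lift_def
    by (simp add: fract_lift_to_fract_id
        fract_lift_fract_lift[OF ring_embedding_comp[OF ring_embedding_to_fract
          ring_embedding_map_poly[OF s']] ring_embedding_map_poly[OF t']])
qed

lemma bij_shift_lift:
  assumes "ring_embedding \<sigma>" "ring_embedding \<tau>" "\<And>p. \<sigma> (\<tau> p) = p" "\<And>p. \<tau> (\<sigma> p) = p"
  shows "bij (shift_lift \<sigma>)"
  by (rule bijI', metis shift_lift_inverse assms, metis shift_lift_inverse assms)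

lemma pcompose_shift_inverse:
  fixes p :: "'r::idom poly"
  assumes "r + s = 0"
  shows "pcompose (pcompose p [:r, 1:]) [:s, 1:] = p"
proof -
  have "pcompose [:r, 1:] [:s, 1:] = [:0, 1:]"
    using assms by (simp add: pcompose_pCons)
  then show ?thesis
    by (simp add: pcompose_assoc[symmetric] pcompose_idR)
qed

lemma map_poly_inverse:
  assumes "ring_embedding f" "ring_embedding g" "\<And>x. f (g x) = x"
  shows "map_poly f (map_poly g p) = p"
  by (intro poly_eqI) (simp add: coeff_map_poly ring_embeddingD(4)[OF assms(1)] ring_embeddingD(4)[OF assms(2)] assms(3))

lemma bij_shifts: "bij S\<^sub>a" "bij S\<^sub>b" "bij S\<^sub>c"
proof -
  note e0 = ring_embedding_pcompose
  note e1 = ring_embedding_map_poly[OF e0]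
  note e2 = ring_embedding_map_poly[OF e1]
  have i0: "pcompose (pcompose p [:1, 1:]) [:- 1, 1:] = p"
    "pcompose (pcompose p [:- 1, 1:]) [:1, 1:] = p" for p :: "'r::idom poly"
    by (simp_all add: pcompose_shift_inverse)
  note i1 = map_poly_inverse[OF e0 e0 i0(1)] map_poly_inverse[OF e0 e0 i0(2)]
  note i2 = map_poly_inverse[OF e1 e1 i1(1)] map_poly_inverse[OF e1 e1 i1(2)]
  show "bij S\<^sub>a"
    unfolding shift_a_def by (rule bij_shift_lift[OF e2 e2 i2(2) i2(1)])
  show "bij S\<^sub>b"
    unfolding shift_b_def by (rule bij_shift_lift[OF e1 e1 i1(2) i1(1)])
  show "bij S\<^sub>c"
    unfolding shift_c_def by (rule bij_shift_lift[OF e0 e0 i0(2) i0(1)])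
qed

lemma ring_embedding_shifts:
  "ring_embedding S\<^sub>a" "ring_embedding S\<^sub>b" "ring_embedding S\<^sub>c"
  unfolding shift_a_def shift_b_def shift_c_def
  by (rule ring_embedding_shift_lift[OF ring_embedding_map_poly[OF ring_embedding_map_poly[OF
        ring_embedding_pcompose]]]
      ring_embedding_shift_lift[OF ring_embedding_map_poly[OF ring_embedding_pcompose]]
      ring_embedding_shift_lift[OF ring_embedding_pcompose])+

lemma shift_lift_variables:
  assumes s: "ring_embedding \<sigma>"
  shows "shift_lift \<sigma> (to_fract [:to_fract p:]) = to_fract [:to_fract (\<sigma> p):]"
    and "shift_lift \<sigma> \<^bold>z = \<^bold>z"
proof -
  let ?\<sigma> = "fract_lift (\<lambda>q. to_fract (\<sigma> q))"
  have s1: "ring_embedding (\<lambda>q. to_fract (\<sigma> q))"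
    by (rule ring_embedding_comp[OF ring_embedding_to_fract s])
  have s2: "ring_embedding ?\<sigma>"
    by (rule ring_embedding_fract_lift[OF s1])
  have s3: "ring_embedding (\<lambda>p. to_fract (map_poly ?\<sigma> p))"
    by (rule ring_embedding_comp[OF ring_embedding_to_fract ring_embedding_map_poly[OF s2]])
  show "shift_lift \<sigma> (to_fract [:to_fract p:]) = to_fract [:to_fract (\<sigma> p):]"
    by (simp add: shift_lift_def fract_lift_to_fract[OF s3] fract_lift_to_fract[OF s1] map_poly_pCons
        ring_embeddingD[OF s2])
  show "shift_lift \<sigma> \<^bold>z = \<^bold>z"
    by (simp add: shift_lift_def var_z_def fract_lift_to_fract[OF s3] map_poly_pCons
        ring_embeddingD[OF s2])
qed

lemma shift_variables:
  "S\<^sub>a \<^bold>a = \<^bold>a + 1" "S\<^sub>a \<^bold>b = \<^bold>b" "S\<^sub>a \<^bold>c = \<^bold>c" "S\<^sub>a \<^bold>z = \<^bold>z"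
  "S\<^sub>b \<^bold>a = \<^bold>a" "S\<^sub>b \<^bold>b = \<^bold>b + 1" "S\<^sub>b \<^bold>c = \<^bold>c" "S\<^sub>b \<^bold>z = \<^bold>z"
  "S\<^sub>c \<^bold>a = \<^bold>a" "S\<^sub>c \<^bold>b = \<^bold>b" "S\<^sub>c \<^bold>c = \<^bold>c + 1" "S\<^sub>c \<^bold>z = \<^bold>z"
proof -
  have lift: "to_fract [:to_fract (p + 1):] = to_fract [:to_fract p:] + (1 :: Cabcz)"
    for p :: "complex poly poly poly"
  proof -
    have "[:to_fract (p + 1):] = [:to_fract p:] + 1"
      by (simp add: one_pCons[where 'a = Cabc])
    then show ?thesis by (simp only: to_fract_add to_fract_1)
  qed
  have succ: "[:[:[:1, 1:]:]:] = [:[:[:0, 1:]:]:] + (1 :: complex poly poly poly)"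
    "[:[:1, 1:]:] = [:[:0, 1:]:] + (1 :: complex poly poly poly)"
    "[:1, 1:] = [:0, 1:] + (1 :: complex poly poly poly)"
    by (simp_all add: one_pCons)
  note lift' = lift[of "[:[:[:0, 1:]:]:]", folded succ] lift[of "[:[:0, 1:]:]", folded succ]
    lift[of "[:0, 1:]", folded succ]
  note e = ring_embedding_pcompose[of 1]
  note e' = e ring_embedding_map_poly[OF e] ring_embedding_map_poly[OF ring_embedding_map_poly[OF e]]
  note [simp] = shift_lift_variables[OF e'(1)] shift_lift_variables[OF e'(2)]
    shift_lift_variables[OF e'(3)] map_poly_pCons pcompose_pCons pcompose_1
  show "S\<^sub>a \<^bold>a = \<^bold>a + 1" "S\<^sub>a \<^bold>b = \<^bold>b" "S\<^sub>a \<^bold>c = \<^bold>c" "S\<^sub>a \<^bold>z = \<^bold>z"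
    "S\<^sub>b \<^bold>a = \<^bold>a" "S\<^sub>b \<^bold>b = \<^bold>b + 1" "S\<^sub>b \<^bold>c = \<^bold>c" "S\<^sub>b \<^bold>z = \<^bold>z"
    "S\<^sub>c \<^bold>a = \<^bold>a" "S\<^sub>c \<^bold>b = \<^bold>b" "S\<^sub>c \<^bold>c = \<^bold>c + 1" "S\<^sub>c \<^bold>z = \<^bold>z"
    unfolding shift_a_def shift_b_def shift_c_def
    by (simp_all add: var_a_def var_b_def var_c_def par_a_def par_b_def par_c_def lift')
qed

lemma ring_embedding_laurent: "ring_embedding laurent"
  unfolding laurent_def
  by (rule ring_embedding_fract_lift, rule ring_embeddingI)
    (simp_all add: fps_of_poly_add fps_of_poly_mult fls_times_fps_to_fls)

end

theory Submission
  imports Defs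
begin

text \<open>
  Uniqueness of \<open>P\<close> and \<open>Q\<close> means that \<open>F(a,b;c)\<close> and \<open>F(a+1,b;c)\<close> are linearly independent over
  \<open>\<complex>(a,b,c,z)\<close>, equivalently that \<open>F\<close> has no rational logarithmic derivative. The shifts extend
  coefficientwise to Laurent series, where they move \<open>F\<close> to its contiguous functions; hence every
  relation between contiguous functions may be shifted, and by independence it passes to \<open>P\<close>
  and \<open>Q\<close>. The transition matrices between the pairs
  \<open>(F(a+k,b+l;c+m), F(a+k+1,b+l;c+m))\<close> satisfy a cocycle identity. Their determinants are products
  of shifts of the three determinants of the unit steps, which gives existence, because these are
  nonzero, and the Pochhammer quotient in (d). The remaining identities are instances of the
  cocycle identity.
\<close>

text \<open>Independence fails for special parameters: for b = c the series is the binomial series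
  of exponent - a, whose logarithmic derivative a / (1 - z) is rational. The proof must therefore
  exploit that a, b, c - a and c - b are not integers, and it does so by balancing local exponents.
  A rational logarithmic derivative of F would show exponent a or b at infinity, 0 or c - a - b at
  1, and integers elsewhere, and these cannot be matched.

  A second obstacle is the sign of the indices. Negative powers of a shift are iterates of the
  inverse of a bijection, for which there is no formula. Statements indexed by integers are
  therefore carried along the lattice as equivalences between neighbours, so that one computation
  for a positive unit step serves both directions.\<close>

unbundle fps_syntax

subsection \<open>The Gauss series over a field of characteristic zero\<close>

abbreviation hypergeo :: "'a::field_char_0 \<Rightarrow> 'a \<Rightarrow> 'a \<Rightarrow> 'a fps" where
  "hypergeo a b c \<equiv> fps_hypergeo [a, b] [c] 1"

lemma pochhammer_plus1: "x * pochhammer (x + 1) n = (x + of_nat n) * pochhammer x n"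
  for x :: "'a::comm_semiring_1"
  by (metis pochhammer_rec pochhammer_rec')

lemma pochhammer_nz:
  fixes c :: "'a::field_char_0"
  assumes "\<And>n. c + of_nat n \<noteq> 0"
  shows "pochhammer c n \<noteq> 0"
  using assms by (metis pochhammer_eq_0_iff add.commute neg_eq_iff_add_eq_0)

text \<open>Both x (x + 1)_n and (x + n) (x)_n equal (x)_(n+1), and the remaining factors of the
  coefficient do not depend on the shifted parameter.\<close>

lemma hypergeo_nth_plus1:
  "a * hypergeo (a + 1) b c $ n = (a + of_nat n) * hypergeo a b c $ n"
  "b * hypergeo a (b + 1) c $ n = (b + of_nat n) * hypergeo a b c $ n"
proof -
  have "a * (pochhammer (a + 1) n * x) = (a + of_nat n) * (pochhammer a n * x)" for a x :: 'a
    by (simp only: mult.assoc[symmetric] pochhammer_plus1)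
  note * = this[of a "pochhammer b n"] this[of b "pochhammer a n"]
  show "a * hypergeo (a + 1) b c $ n = (a + of_nat n) * hypergeo a b c $ n"
    using *(1) by (simp only: fps_hypergeo_nth foldl.simps mult_1 power_one mult_1_right times_divide_eq_right mult_ac)
  show "b * hypergeo a (b + 1) c $ n = (b + of_nat n) * hypergeo a b c $ n"
    using *(2) by (simp only: fps_hypergeo_nth foldl.simps mult_1 power_one mult_1_right times_divide_eq_right mult_ac)
qed

lemma hypergeo_nth_c:
  assumes c: "\<And>n. c + of_nat n \<noteq> 0"
  shows "(c + of_nat n) * hypergeo a b (c + 1) $ n = c * hypergeo a b c $ n"
proof -
  have "c + 1 + of_nat n \<noteq> 0" for n
    using c[of "Suc n"] by (simp add: add_ac)
  note * = pochhammer_nz[OF this, of n] pochhammer_nz[OF c, of n] c[of n] c[of 0]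
  have "(c + of_nat n) / pochhammer (c + 1) n = c / pochhammer c n"
    using * pochhammer_plus1[of c n] by (simp add: field_simps)
  then have "(c + of_nat n) / pochhammer (c + 1) n * x = c / pochhammer c n * x" for x
    by simp
  from this[of "pochhammer a n * pochhammer b n / fact n"] show ?thesis by (simp add: mult_ac)
qed

lemma hypergeo_nth_Suc:
  assumes c: "\<And>n. c + of_nat n \<noteq> 0"
  shows "(c + of_nat n) * of_nat (Suc n) * hypergeo a b c $ Suc n
    = (a + of_nat n) * (b + of_nat n) * hypergeo a b c $ n"
  unfolding fps_hypergeo_rec using c[of n] by (simp del: of_nat_Suc fps_hypergeo_nth)

lemma hypergeo_ode:
  assumes c: "\<And>n. c + of_nat n \<noteq> 0"
  shows "fps_of_poly ([:0, 1:] * [:1, -1:]) * fps_deriv (fps_deriv (hypergeo a b c))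
     + fps_of_poly [:c, - (a + b + 1):] * fps_deriv (hypergeo a b c)
     = fps_const (a * b) * hypergeo a b c"
proof (rule fps_ext)
  fix n
  define u where "u = hypergeo a b c"
  have u: "(c + of_nat n) * of_nat (Suc n) * u $ Suc n = (a + of_nat n) * (b + of_nat n) * u $ n" for n
    unfolding u_def by (rule hypergeo_nth_Suc[OF c])
  have p: "fps_of_poly ([:0, 1:] * [:1, -1 :: 'a:]) = fps_X - fps_X * fps_X"
    by (simp add: fps_of_poly_pCons algebra_simps)
  have q: "fps_of_poly [:c, - (a + b + 1):] = fps_const c - fps_const (a + b + 1) * fps_X"
    by (simp add: fps_of_poly_pCons algebra_simps)
  have XX: "fps_X * fps_X * f = fps_X * (fps_X * f)" for f :: "'a fps" by simp
  \<comment> \<open>The factors z and z^2 move the coefficient index, which makes n = 0 and n = 1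
    boundary cases; in every case the identity is the two-term recurrence \<open>u\<close>.\<close>
  have "(fps_of_poly ([:0, 1:] * [:1, -1:]) * fps_deriv (fps_deriv u)
     + fps_of_poly [:c, - (a + b + 1):] * fps_deriv u) $ n = (fps_const (a * b) * u) $ n"
    using u[of n] unfolding p q
    by (cases n rule: nat.exhaust; cases "n - 1" rule: nat.exhaust) 
       (simp_all add: left_diff_distrib XX mult.assoc del: of_nat_Suc, simp_all add: algebra_simps)
  then show "(fps_of_poly ([:0, 1:] * [:1, -1:]) * fps_deriv (fps_deriv (hypergeo a b c))
     + fps_of_poly [:c, - (a + b + 1):] * fps_deriv (hypergeo a b c)) $ n
     = (fps_const (a * b) * hypergeo a b c) $ n"
    unfolding u_def .
qed

text \<open>
  The denominators \<open>D\<close> for which \<open>D F'\<close> is a polynomial multiple of \<open>F\<close> form an ideal. By the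
  differential equation this ideal contains \<open>z (1 - z) (N - D')\<close> whenever \<open>D F' = N F\<close>. Divisibility of
  this element by a generator \<open>D\<close>, compared at \<open>0\<close>, \<open>1\<close> and \<open>\<infinity>\<close>, forces \<open>c - a\<close> or \<open>c - b\<close> to be an integer.
\<close>

lemma hypergeo_logderiv_irrational:
  fixes F :: "'a::field_char_0 fps" and N D :: "'a poly"
  assumes F0: "F $ 0 \<noteq> 0"
    and ode: "fps_of_poly ([:0, 1:] * [:1, -1:]) * fps_deriv (fps_deriv F)
     + fps_of_poly [:c, - (a + b + 1):] * fps_deriv F = fps_const (a * b) * F"
    and nz: "\<And>n. a + of_nat n \<noteq> 0" "\<And>n. b + of_nat n \<noteq> 0"
      "\<And>n. c - a + of_nat n \<noteq> 0" "\<And>n. c - b + of_nat n \<noteq> 0"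
    and DN: "fps_of_poly D * fps_deriv F = fps_of_poly N * F"
  shows "D = 0"
proof (rule ccontr)
  assume D: "D \<noteq> 0"
  let ?p = "fps_of_poly" and ?z = "[:0, 1:] :: 'a poly" and ?w = "[:1, -1:] :: 'a poly"
  note hom = fps_of_poly_add fps_of_poly_mult fps_of_poly_diff fps_of_poly_uminus
  define S where "S D N \<longleftrightarrow> ?p D * fps_deriv F = ?p N * F" for D N
  have F: "F \<noteq> 0" using F0 by auto
  define I where "I D \<longleftrightarrow> D \<noteq> 0 \<and> (\<exists>N. S D N)" for D
  have "I D" using D DN by (auto simp: I_def S_def)
  \<comment> \<open>From here on \<open>D\<close> is an element of least degree in the ideal of
    admissible denominators, hence a generator, and no longer the given denominator.\<close>
  then obtain D where D: "I D" and min: "\<And>E. I E \<Longrightarrow> degree D \<le> degree E"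
    using ex_has_least_nat[of I D degree] by blast
  then obtain N where D0: "D \<noteq> 0" and DN: "S D N" by (auto simp: I_def)
  have S_uniq: "S E M \<Longrightarrow> S E M' \<Longrightarrow> M = M'" for E M M'
    using F by (simp add: S_def)
  have S_mult: "S E M \<Longrightarrow> S (E * R) (M * R)" for E M R
    unfolding S_def hom by algebra
  have S_diff: "S E M \<Longrightarrow> S E' M' \<Longrightarrow> S (E - E') (M - M')" for E M E' M'
    unfolding S_def hom by algebra
  have S_cancel: "S E M" if "S (R * E) (R * M)" "R \<noteq> 0" for R E M
    using that unfolding S_def hom by (simp add: mult.assoc)
  have dvd: "D dvd E" if E: "S E M" for E M
  proof (rule ccontr)
    assume "\<not> D dvd E"
    then have nz: "E mod D \<noteq> 0" by (simp add: mod_eq_0_iff_dvd)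
    have "S (E - D * (E div D)) (M - N * (E div D))"
      by (intro S_diff S_mult E DN)
    then have "I (E mod D)" using nz by (auto simp: I_def minus_mult_div_eq_mod)
    then show False using min degree_mod_less'[OF D0 nz] by force
  qed
  \<comment> \<open>A common root could be cancelled from both polynomials, against the minimality
    of the degree.\<close>
  have coprime: False if r: "poly D r = 0" "poly N r = 0" for r
  proof -
    obtain D' N' where D': "D = [:-r, 1:] * D'" and N': "N = [:-r, 1:] * N'"
      using r unfolding poly_eq_0_iff_dvd dvd_def by blast
    have "S D' N'"
      by (rule S_cancel[of "[:-r, 1:]"]) (use DN D' N' in auto)
    then have "I D'" using D0 D' by (auto simp: I_def)
    moreover have "degree D = Suc (degree D')"
      using D0 unfolding D' by (subst degree_mult_eq) auto
    ultimately show False using min[of D'] by simp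
  qed
  have D00: "poly D 0 \<noteq> 0"
  proof
    assume *: "poly D 0 = 0"
    have "(?p D * fps_deriv F) $ 0 = (?p N * F) $ 0" using DN by (simp add: S_def)
    then have "poly N 0 = 0" using * F0 by (simp add: poly_0_coeff_0)
    with * show False by (rule coprime)
  qed
  have diff: "?p (pderiv D) * fps_deriv F + ?p D * fps_deriv (fps_deriv F)
      = ?p (pderiv N) * F + ?p N * fps_deriv F"
    using arg_cong[OF DN[unfolded S_def], of fps_deriv] by (simp add: fps_of_poly_pderiv algebra_simps)
  \<comment> \<open>Multiply the derivative of \<open>D F' = N F\<close> by z (1 - z) and remove F''
    with the differential equation; the remaining term \<open>D F'\<close> is traded for
    \<open>N F\<close>.\<close>
  have "S (?z * ?w * (N - pderiv D)) ([:a * b:] * D - ?z * ?w * pderiv N - [:c, - (a + b + 1):] * N)"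
  proof -
    have "?p [:a * b:] = fps_const (a * b)" by simp
    moreover have "x * (n - d') * f' = (r * d - x * n' - q * n) * f"
      if "d' * f' + d * f'' = n' * f + n * f'" "x * f'' + q * f' = r * f" "d * f' = n * f"
      for d d' f f' f'' n n' q r x :: "'a fps"
      using that by algebra
    ultimately show ?thesis
      using diff ode DN unfolding S_def hom by metis
  qed
  note S1 = this
  from dvd[OF S1] obtain T where T: "?z * ?w * (N - pderiv D) = D * T" by (auto simp: dvd_def)
  have "poly (?z * ?w * (N - pderiv D)) 0 = 0" by simp
  then have "poly T 0 = 0" using D00 unfolding T by simp
  then obtain U where U: "T = ?z * U" by (auto simp: poly_eq_0_iff_dvd dvd_def)
  have A: "?w * (N - pderiv D) = D * U"
  proof -
    have "?z * (?w * (N - pderiv D)) = ?z * (D * U)" using T unfolding U by (simp only: mult_ac)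
    then show ?thesis by (subst (asm) mult_left_cancel) auto
  qed
  \<comment> \<open>The two numerators belonging to the denominator \<open>D * T\<close> must agree.
    Together, A and B are the Riccati equation of the logarithmic derivative N/D, cleared of
    denominators.\<close>
  have B: "?z * N * U + ?z * ?w * pderiv N + [:c, - (a + b + 1):] * N = [:a * b:] * D"
    using S_uniq[OF S1 S_mult[OF DN, of T, folded T]] unfolding U by algebra
  have ab: "a * b \<noteq> 0" using nz(1,2)[of 0] by simp
  have N0: "N \<noteq> 0" using B ab D0 by auto
  define n where "n = degree N"
  have degr: "degree (?z * ?w * pderiv N + [:c, - (a + b + 1):] * N) \<le> n + 1"
  proof (rule degree_add_le)
    show "degree (?z * ?w * pderiv N) \<le> n + 1"
    proof (cases "n = 0")
      case True
      then have "pderiv N = 0" by (simp add: n_def pderiv_eq_0_iff)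
      then show ?thesis by simp
    next
      case False
      have "degree (?z * ?w * pderiv N) \<le> 2 + degree (pderiv N)"
        using degree_mult_le[of "?z * ?w" "pderiv N"] by simp
      also have "\<dots> = n + 1" using False by (simp add: degree_pderiv n_def)
      finally show ?thesis .
    qed
    show "degree ([:c, - (a + b + 1):] * N) \<le> n + 1"
      using degree_mult_le[of "[:c, - (a + b + 1):]" N] by (auto simp: n_def split: if_splits)
  qed
  \<comment> \<open>For nonconstant \<open>U\<close> the top term of B would force
    \<open>degree D = n + 1 + degree U\<close>. The left side of A would then have degree at most
    \<open>degree D\<close>, less than that of \<open>D * U\<close>.\<close>
  have degU: "degree U = 0"
  proof (rule ccontr)
    assume U1: "degree U \<noteq> 0"
    then have U0: "U \<noteq> 0" by auto
    have "degree (?z * N * U) = n + 1 + degree U"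
      using N0 U0 by (simp add: degree_mult_eq n_def)
    then have "degree (?z * N * U + (?z * ?w * pderiv N + [:c, - (a + b + 1):] * N)) = n + 1 + degree U"
      using degr U1 by (subst degree_add_eq_left) auto
    moreover have "degree ([:a * b:] * D) = degree D"
      using ab by simp
    ultimately have d: "degree D = n + 1 + degree U"
      using B unfolding add.assoc[of "?z * N * U"] by metis
    have "degree (D * U) \<le> degree ?w + degree (N - pderiv D)"
      unfolding A[symmetric] by (rule degree_mult_le)
    also have "degree (N - pderiv D) \<le> degree D - 1"
      using d by (intro degree_diff_le) (auto simp: n_def degree_pderiv)
    finally show False using d U1 D0 U0 by (simp add: degree_mult_eq)
  qed
  then obtain t where t: "U = [:t:]" by (rule degree_eq_zeroE)
  have degD: "degree D \<le> n + 1"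
  proof -
    have "degree (?z * N * U) \<le> n + 1"
      using degree_mult_le[of "?z * N" U] N0 degU by (simp add: degree_mult_eq n_def)
    then have "degree ([:a * b:] * D) \<le> n + 1"
      unfolding B[symmetric] add.assoc[of "?z * N * U"] using degr by (rule degree_add_le)
    then show ?thesis using ab by simp
  qed
  \<comment> \<open>These are the coefficients that decide the behaviour at infinity.
    \<open>e\<close> is taken at index n + 1, the largest degree that \<open>D\<close> can have; it
    turns out to be nonzero.\<close>
  define v e where "v = coeff N n" and "e = coeff D (n + 1)"
  have v: "v \<noteq> 0" using N0 by (simp add: v_def n_def)
  have "coeff (?z * N * U + ?z * ?w * pderiv N + [:c, - (a + b + 1):] * N) (n + 1) = a * b * e"
    unfolding B by (simp add: e_def)
  then have 1: "v * (t - of_nat (n + 1) - a - b) = a * b * e"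
    by (cases n) (simp_all add: t v_def coeff_pderiv coeff_eq_0 n_def algebra_simps)
  have "coeff (?w * (N - pderiv D)) (n + 1) = t * e"
    unfolding A by (simp add: e_def t)
  then have 2: "e * (t - of_nat (n + 1)) = - v"
    using coeff_eq_0[of N "n + 1"] coeff_eq_0[of D "n + 2"] degD
    by (simp add: v_def e_def coeff_pderiv n_def algebra_simps)
  have "e \<noteq> 0" using 2 v by auto
  \<comment> \<open>Put s = t - (n + 1). By 2, N/D behaves like - s / z at infinity, so this is the
    indicial equation at infinity, whose roots are a and b.\<close>
  have "e * ((t - of_nat (n + 1) - a) * (t - of_nat (n + 1) - b)) = 0"
    using 1 2 by algebra
  then have t': "t = a + of_nat (n + 1) \<or> t = b + of_nat (n + 1)"
    using \<open>e \<noteq> 0\<close> by (simp add: diff_diff_eq add.commute)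
  then have "t \<noteq> 0" using nz(1,2)[of "n + 1"] by metis
  \<comment> \<open>At z = 1 the left side of A vanishes and t is nonzero, hence D(1) = 0.
    Evaluating B there gives t = a + b + 1 - c, which with either value of t makes c - b + n or c -
    a + n vanish.\<close>
  have "poly (?w * (N - pderiv D)) 1 = 0" by simp
  then have D1: "poly D 1 = 0" using \<open>t \<noteq> 0\<close> unfolding A t by simp
  have "poly N 1 * (t + c - a - b - 1) = 0"
    using arg_cong[OF B, of "\<lambda>p. poly p 1"] D1 unfolding t by (simp add: algebra_simps)
  moreover have "poly N 1 \<noteq> 0" using coprime[OF D1] by auto
  ultimately have "t + c - a - b - 1 = 0" by simp
  then show False using t' nz(3,4)[of n] by (auto simp: algebra_simps)
qed

subsection \<open>Shifting Laurent series coefficientwise\<close>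

text \<open>The value is meaningful only if \<open>h 0 = 0\<close>; otherwise the coefficients do not vanish at \<open>-\<infinity>\<close>.\<close>

definition fls_map :: "('a::zero \<Rightarrow> 'b::zero) \<Rightarrow> 'a fls \<Rightarrow> 'b fls" where
  "fls_map h f = Abs_fls (\<lambda>n. h (f $$ n))"

context
  fixes h :: "'a::comm_ring_1 \<Rightarrow> 'b::comm_ring_1"
  assumes h: "ring_embedding h"
begin

lemma ring_embedding_sum: "h (sum f A) = (\<Sum>i\<in>A. h (f i))"
  by (induction A rule: infinite_finite_induct) (simp_all add: ring_embeddingD[OF h])

lemma ring_embedding_uminus: "h (- x) = - h x"
  using ring_embeddingD(1)[OF h, of x "- x"] by (simp add: ring_embeddingD[OF h] eq_neg_iff_add_eq_0 add.commute)

lemma ring_embedding_diff: "h (x - y) = h x - h y"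
  using ring_embeddingD(1)[OF h, of x "- y"] by (simp add: ring_embedding_uminus)

lemma ring_embedding_of_nat: "h (of_nat n) = of_nat n"
  by (induction n) (simp_all add: ring_embeddingD[OF h])

lemma ring_embedding_of_int: "h (of_int n) = of_int n"
  by (cases n rule: int_cases2) (simp_all add: ring_embedding_of_nat ring_embedding_uminus)

lemma ring_embedding_pochhammer: "h (pochhammer x n) = pochhammer (h x) n"
  by (induction n) (simp_all add: pochhammer_Suc ring_embeddingD[OF h] ring_embedding_of_nat)

end

context
  fixes h :: "'a::field \<Rightarrow> 'b::field"
  assumes h: "ring_embedding h"
begin

lemma fls_map_nth [simp]: "fls_map h f $$ n = h (f $$ n)"
proof -
  have "\<forall>m<fls_subdegree f. h (f $$ m) = 0"
    by (simp add: ring_embeddingD[OF h])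
  then show ?thesis
    unfolding fls_map_def by (rule nth_Abs_fls_lower_bound)
qed

text \<open>Injectivity keeps the lowest coefficient nonzero. The product formula for Laurent series
  sums over a range bounded by the subdegrees, so this is what makes \<open>fls_map h\<close>
  multiplicative.\<close>

lemma fls_subdegree_map: "fls_subdegree (fls_map h f) = fls_subdegree f"
proof (cases "f = 0")
  case True
  then have "fls_map h f = 0" by (intro fls_eqI) (simp add: ring_embeddingD[OF h])
  with True show ?thesis by simp
next
  case False
  then show ?thesis
    by (intro fls_subdegree_eqI) (simp_all add: ring_embeddingD[OF h])
qed

lemma ring_embedding_inverse: "h (inverse x) = inverse (h x)"
proof (cases "x = 0")
  case False
  then have "h x * h (inverse x) = 1"
    by (simp add: ring_embeddingD(3)[OF h] flip: ring_embeddingD(2)[OF h])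
  then show ?thesis by (simp add: inverse_unique)
qed (simp add: ring_embeddingD[OF h])

lemma ring_embedding_divide: "h (x / y) = h x / h y"
  by (simp add: divide_inverse ring_embeddingD[OF h] ring_embedding_inverse)

lemma ring_embedding_fls_map: "ring_embedding (fls_map h)"
proof (rule ring_embeddingI)
  fix f g :: "'a fls"
  show "fls_map h (f + g) = fls_map h f + fls_map h g"
    by (intro fls_eqI) (simp add: ring_embeddingD[OF h])
  show "fls_map h (f * g) = fls_map h f * fls_map h g"
    by (intro fls_eqI)
      (simp add: fls_times_nth(2) fls_subdegree_map ring_embedding_sum[OF h] ring_embeddingD[OF h])
  show "fls_map h f = 0 \<Longrightarrow> f = 0"
    by (intro fls_eqI) (auto simp: fls_eq_iff ring_embeddingD[OF h])
qed (intro fls_eqI, simp add: ring_embeddingD[OF h])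

lemma fls_map_poly:
  "fls_map h (fps_to_fls (fps_of_poly p)) = fps_to_fls (fps_of_poly (map_poly h p))"
  by (intro fls_eqI) (simp add: coeff_map_poly ring_embeddingD[OF h])

end

lemma fls_map_hypergeo:
  fixes h :: "'a::field_char_0 \<Rightarrow> 'b::field_char_0"
  assumes h: "ring_embedding h"
  shows "fls_map h (fps_to_fls (hypergeo a b c)) = fps_to_fls (hypergeo (h a) (h b) (h c))"
proof -
  have fact: "h (fact n) = fact n" for n
    using ring_embedding_of_nat[OF h, of "fact n"] by simp
  show ?thesis
  by (intro fls_eqI)
    (simp add: fls_map_nth[OF h] ring_embeddingD[OF h] ring_embedding_divide[OF h]
      fact ring_embedding_pochhammer[OF h])
qed

abbreviation coeff_shift ::
    "(complex poly poly poly \<Rightarrow> complex poly poly poly) \<Rightarrow> Cabc \<Rightarrow> Cabc" where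
  "coeff_shift \<sigma> \<equiv> fract_lift (\<lambda>q. to_fract (\<sigma> q))"

lemma ring_embedding_coeff_shift: "ring_embedding \<sigma> \<Longrightarrow> ring_embedding (coeff_shift \<sigma>)"
  by (rule ring_embedding_fract_lift[OF ring_embedding_comp[OF ring_embedding_to_fract]])

lemma coeff_shift_to_fract: "ring_embedding \<sigma> \<Longrightarrow> coeff_shift \<sigma> (to_fract p) = to_fract (\<sigma> p)"
  by (rule fract_lift_to_fract[OF ring_embedding_comp[OF ring_embedding_to_fract]])

lemma laurent_Fract:
  assumes "q \<noteq> 0"
  shows "laurent (Fract p q) = fps_to_fls (fps_of_poly p) / fps_to_fls (fps_of_poly q)"
  unfolding laurent_def
  by (rule fract_lift_embedding[OF _ assms], rule ring_embeddingI)
    (simp_all add: fps_of_poly_add fps_of_poly_mult fls_times_fps_to_fls)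

lemma laurent_to_fract: "laurent (to_fract p) = fps_to_fls (fps_of_poly p)"
  by (simp add: to_fract_def laurent_Fract)

text \<open>A shift fixes z, so on a quotient of polynomials in z it only changes coefficients, and
  expanding at z = 0 commutes with it. This ties the shift of rational functions to the shift of
  series.\<close>

lemma fls_map_laurent:
  assumes \<sigma>: "ring_embedding \<sigma>"
  shows "fls_map (coeff_shift \<sigma>) (laurent x) = laurent (shift_lift \<sigma> x)"
proof -
  let ?s = "coeff_shift \<sigma>"
  note s = ring_embedding_coeff_shift[OF \<sigma>]
  note e = ring_embedding_comp[OF ring_embedding_to_fract ring_embedding_map_poly[OF s]]
  obtain p q where x: "x = Fract p q" "q \<noteq> 0" by (cases x)
  have "shift_lift \<sigma> x = to_fract (map_poly ?s p) / to_fract (map_poly ?s q)"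
    unfolding shift_lift_def x(1) by (rule fract_lift_embedding[OF e x(2)])
  then show ?thesis
    using x(2) by (simp add: x(1) laurent_Fract ring_embedding_divide[OF ring_embedding_fls_map[OF s]]
      ring_embedding_divide[OF ring_embedding_laurent] fls_map_poly[OF s] laurent_to_fract)
qed

text \<open>Explicit nested polynomials make nonvanishing a matter of inspecting coefficients: in c
  - a + k the outermost variable c has leading coefficient 1.\<close>

lemma param_eqs:
  "par_a + of_int k = to_fract [:[:[:of_int k, 1:]:]:]"
  "par_b + of_int k = to_fract [:[:of_int k, 1:]:]"
  "par_c + of_int k = to_fract [:of_int k, 1:]"
  "par_c - par_a + of_int k = to_fract [:[:[:of_int k, -1:]:], 1:]"
  "par_c - par_b + of_int k = to_fract [:[:of_int k, -1:], 1:]"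
proof -
  have "(of_int k :: Cabc) = to_fract (of_int k)"
    by (simp add: ring_embedding_of_int[OF ring_embedding_to_fract])
  then show "par_a + of_int k = to_fract [:[:[:of_int k, 1:]:]:]"
    "par_b + of_int k = to_fract [:[:of_int k, 1:]:]"
    "par_c + of_int k = to_fract [:of_int k, 1:]"
    "par_c - par_a + of_int k = to_fract [:[:[:of_int k, -1:]:], 1:]"
    "par_c - par_b + of_int k = to_fract [:[:of_int k, -1:], 1:]"
    by (simp_all add: par_a_def par_b_def par_c_def of_int_poly flip: to_fract_add to_fract_diff)
qed

lemma param_nonzero:
  "par_a + of_int k \<noteq> 0" "par_b + of_int k \<noteq> 0" "par_c + of_int k \<noteq> 0"
  "par_c - par_a + of_int k \<noteq> 0" "par_c - par_b + of_int k \<noteq> 0"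
  by (simp_all add: param_eqs)

lemma fls_map_hypF:
  assumes \<sigma>: "ring_embedding \<sigma>"
    and par: "coeff_shift \<sigma> par_a = par_a + of_int i" "coeff_shift \<sigma> par_b = par_b + of_int j"
      "coeff_shift \<sigma> par_c = par_c + of_int n"
  shows "fls_map (coeff_shift \<sigma>) (\<^bold>F k l m) = \<^bold>F (k + i) (l + j) (m + n)"
  unfolding hypF_def fls_map_hypergeo[OF ring_embedding_coeff_shift[OF \<sigma>]]
  by (simp add: ring_embeddingD[OF ring_embedding_coeff_shift[OF \<sigma>]] par add_ac
      ring_embedding_of_int[OF ring_embedding_coeff_shift[OF \<sigma>]])

text \<open>The left sum is the image of the right one under a coefficientwise map that is an
  injective ring homomorphism. Injectivity gives the converse direction, through which relations are
  shifted backwards.\<close>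

lemma relation_shift_lift:
  assumes \<sigma>: "ring_embedding \<sigma>"
    and par: "coeff_shift \<sigma> par_a = par_a + of_int i" "coeff_shift \<sigma> par_b = par_b + of_int j"
      "coeff_shift \<sigma> par_c = par_c + of_int n"
  shows "(\<Sum>x\<in>I. laurent (shift_lift \<sigma> (f x)) * \<^bold>F (\<alpha> x + i) (\<beta> x + j) (\<gamma> x + n)) = 0 \<longleftrightarrow>
    (\<Sum>x\<in>I. laurent (f x) * \<^bold>F (\<alpha> x) (\<beta> x) (\<gamma> x)) = 0"
proof -
  note e = ring_embedding_fls_map[OF ring_embedding_coeff_shift[OF \<sigma>]]
  have "(\<Sum>x\<in>I. laurent (shift_lift \<sigma> (f x)) * \<^bold>F (\<alpha> x + i) (\<beta> x + j) (\<gamma> x + n))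
    = fls_map (coeff_shift \<sigma>) (\<Sum>x\<in>I. laurent (f x) * \<^bold>F (\<alpha> x) (\<beta> x) (\<gamma> x))"
    by (simp add: ring_embedding_sum[OF e] ring_embeddingD[OF e] fls_map_laurent[OF \<sigma>]
        fls_map_hypF[OF \<sigma> par])
  then show ?thesis by (simp add: ring_embeddingD[OF e])
qed

lemma relation_shift1:
  fixes f :: "'i \<Rightarrow> Cabcz"
  shows "(\<Sum>x\<in>I. laurent (S\<^sub>a (f x)) * \<^bold>F (\<alpha> x + 1) (\<beta> x) (\<gamma> x)) = 0 \<longleftrightarrow>
      (\<Sum>x\<in>I. laurent (f x) * \<^bold>F (\<alpha> x) (\<beta> x) (\<gamma> x)) = 0"
    and "(\<Sum>x\<in>I. laurent (S\<^sub>b (f x)) * \<^bold>F (\<alpha> x) (\<beta> x + 1) (\<gamma> x)) = 0 \<longleftrightarrow>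
      (\<Sum>x\<in>I. laurent (f x) * \<^bold>F (\<alpha> x) (\<beta> x) (\<gamma> x)) = 0"
    and "(\<Sum>x\<in>I. laurent (S\<^sub>c (f x)) * \<^bold>F (\<alpha> x) (\<beta> x) (\<gamma> x + 1)) = 0 \<longleftrightarrow>
      (\<Sum>x\<in>I. laurent (f x) * \<^bold>F (\<alpha> x) (\<beta> x) (\<gamma> x)) = 0"
proof -
  note e0 = ring_embedding_pcompose[of 1]
  note e1 = ring_embedding_map_poly[OF e0]
  note e2 = ring_embedding_map_poly[OF e1]
  note par = param_eqs(1-3)[of 0, simplified] param_eqs(1-3)[of 1, simplified]
  have par_a: "coeff_shift (map_poly (map_poly (\<lambda>p. pcompose p [:1, 1:]))) par_a = par_a + 1" "coeff_shift (map_poly (map_poly (\<lambda>p. pcompose p [:1, 1:]))) par_b = par_b" "coeff_shift (map_poly (map_poly (\<lambda>p. pcompose p [:1, 1:]))) par_c = par_c"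
    unfolding par(4) unfolding par(1-3)
    by (simp_all add: coeff_shift_to_fract[OF e2] map_poly_pCons pcompose_pCons pcompose_1)
  have par_b: "coeff_shift (map_poly (\<lambda>p. pcompose p [:1, 1:])) par_a = par_a" "coeff_shift (map_poly (\<lambda>p. pcompose p [:1, 1:])) par_b = par_b + 1" "coeff_shift (map_poly (\<lambda>p. pcompose p [:1, 1:])) par_c = par_c"
    unfolding par(5) unfolding par(1-3)
    by (simp_all add: coeff_shift_to_fract[OF e1] map_poly_pCons pcompose_pCons pcompose_1)
  have par_c: "coeff_shift (\<lambda>p. pcompose p [:1, 1:]) par_a = par_a" "coeff_shift (\<lambda>p. pcompose p [:1, 1:]) par_b = par_b" "coeff_shift (\<lambda>p. pcompose p [:1, 1:]) par_c = par_c + 1"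
    unfolding par(6) unfolding par(1-3)
    by (simp_all add: coeff_shift_to_fract[OF e0] map_poly_pCons pcompose_pCons pcompose_1)
  show "(\<Sum>x\<in>I. laurent (S\<^sub>a (f x)) * \<^bold>F (\<alpha> x + 1) (\<beta> x) (\<gamma> x)) = 0 \<longleftrightarrow>
      (\<Sum>x\<in>I. laurent (f x) * \<^bold>F (\<alpha> x) (\<beta> x) (\<gamma> x)) = 0"
    using relation_shift_lift[OF e2, of 1 0 0 f \<alpha> \<beta> \<gamma> I] par_a unfolding shift_a_def
    by simp
  show "(\<Sum>x\<in>I. laurent (S\<^sub>b (f x)) * \<^bold>F (\<alpha> x) (\<beta> x + 1) (\<gamma> x)) = 0 \<longleftrightarrow>
      (\<Sum>x\<in>I. laurent (f x) * \<^bold>F (\<alpha> x) (\<beta> x) (\<gamma> x)) = 0"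
    using relation_shift_lift[OF e1, of 0 1 0 f \<alpha> \<beta> \<gamma> I] par_b unfolding shift_b_def
    by simp
  show "(\<Sum>x\<in>I. laurent (S\<^sub>c (f x)) * \<^bold>F (\<alpha> x) (\<beta> x) (\<gamma> x + 1)) = 0 \<longleftrightarrow>
      (\<Sum>x\<in>I. laurent (f x) * \<^bold>F (\<alpha> x) (\<beta> x) (\<gamma> x)) = 0"
    using relation_shift_lift[OF e0, of 0 0 1 f \<alpha> \<beta> \<gamma> I] par_c unfolding shift_c_def
    by simp
qed

section \<open>Integer powers of the shifts\<close>

lemma int_iter_simps:
  assumes "bij f"
  shows "int_iter f 0 x = x" "int_iter f 1 x = f x" "int_iter f (k + 1) x = f (int_iter f k x)"
proof -
  show 0: "int_iter f 0 x = x" and "int_iter f 1 x = f x" by (simp_all add: int_iter_def)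
  show "int_iter f (k + 1) x = f (int_iter f k x)"
  proof (cases "k \<ge> 0")
    case True
    then show ?thesis by (simp add: int_iter_def nat_add_distrib)
  next
    case False
    \<comment> \<open>For negative k one factor \<open>inv f\<close> is split off so that the outer
      \<open>f\<close> cancels it; k = - 1 lands in the other branch of
      \<open>int_iter\<close>.\<close>
    then have "nat (- k) = Suc (nat (- (k + 1)))" by simp
    then have "f (int_iter f k x) = f (inv f ((inv f ^^ nat (- (k + 1))) x))"
      using False by (simp add: int_iter_def)
    also have "\<dots> = (inv f ^^ nat (- (k + 1))) x"
      by (rule surj_f_inv_f) (rule bij_is_surj[OF assms])
    also have "\<dots> = int_iter f (k + 1) x"
      using False by (cases "k = - 1") (auto simp: int_iter_def)
    finally show ?thesis ..
  qed
qed

text \<open>With an equivalence as step, the single rule for passing from k to k + 1 covers negative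
  integers as well.\<close>

lemma int_iff_induct:
  fixes P :: "int \<Rightarrow> bool"
  assumes "P 0" "\<And>k. P (k + 1) \<longleftrightarrow> P k"
  shows "P k"
  using assms(1)
proof (induction k rule: int_induct[of _ 0])
  case (step2 i)
  then show ?case using assms(2)[of "i - 1"] by simp
qed (use assms(2) in auto)

text \<open>Each variable is treated for arbitrary coefficient and index families, so the three
  equivalences can be chained through the nested composition that defines \<S>.\<close>

lemma relation_shift:
  fixes f :: "'i \<Rightarrow> Cabcz"
  shows "(\<Sum>x\<in>I. laurent (\<S> k l m (f x)) * \<^bold>F (k + \<alpha> x) (l + \<beta> x) (m + \<gamma> x)) = 0 \<longleftrightarrow>
    (\<Sum>x\<in>I. laurent (f x) * \<^bold>F (\<alpha> x) (\<beta> x) (\<gamma> x)) = 0"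
proof -
  have a: "(\<Sum>x\<in>I. laurent (int_iter S\<^sub>a k (f x)) * \<^bold>F (k + \<alpha> x) (\<beta> x) (\<gamma> x)) = 0 \<longleftrightarrow>
    (\<Sum>x\<in>I. laurent (f x) * \<^bold>F (\<alpha> x) (\<beta> x) (\<gamma> x)) = 0" for f :: "'i \<Rightarrow> Cabcz" and \<alpha> \<beta> \<gamma>
  proof (induction k rule: int_iff_induct)
    case (2 k)
    have *: "k + 1 + j = k + j + 1" for j by simp
    show ?case
      using relation_shift1(1)[of "\<lambda>x. int_iter S\<^sub>a k (f x)" "\<lambda>x. k + \<alpha> x" \<beta> \<gamma> I]
      by (simp add: int_iter_simps[OF bij_shifts(1)] *)
  qed (simp add: int_iter_simps[OF bij_shifts(1)])
  have b: "(\<Sum>x\<in>I. laurent (int_iter S\<^sub>b l (f x)) * \<^bold>F (\<alpha> x) (l + \<beta> x) (\<gamma> x)) = 0 \<longleftrightarrow>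
    (\<Sum>x\<in>I. laurent (f x) * \<^bold>F (\<alpha> x) (\<beta> x) (\<gamma> x)) = 0" for f :: "'i \<Rightarrow> Cabcz" and \<alpha> \<beta> \<gamma>
  proof (induction l rule: int_iff_induct)
    case (2 k)
    have *: "k + 1 + j = k + j + 1" for j by simp
    show ?case
      using relation_shift1(2)[of "\<lambda>x. int_iter S\<^sub>b k (f x)" \<alpha> "\<lambda>x. k + \<beta> x" \<gamma> I]
      by (simp add: int_iter_simps[OF bij_shifts(2)] *)
  qed (simp add: int_iter_simps[OF bij_shifts(2)])
  have c: "(\<Sum>x\<in>I. laurent (int_iter S\<^sub>c m (f x)) * \<^bold>F (\<alpha> x) (\<beta> x) (m + \<gamma> x)) = 0 \<longleftrightarrow>
    (\<Sum>x\<in>I. laurent (f x) * \<^bold>F (\<alpha> x) (\<beta> x) (\<gamma> x)) = 0" for f :: "'i \<Rightarrow> Cabcz" and \<alpha> \<beta> \<gamma>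
  proof (induction m rule: int_iff_induct)
    case (2 k)
    have *: "k + 1 + j = k + j + 1" for j by simp
    show ?case
      using relation_shift1(3)[of "\<lambda>x. int_iter S\<^sub>c k (f x)" \<alpha> \<beta> "\<lambda>x. k + \<gamma> x" I]
      by (simp add: int_iter_simps[OF bij_shifts(3)] *)
  qed (simp add: int_iter_simps[OF bij_shifts(3)])
  show ?thesis
    unfolding shift_def a b c ..
qed

lemma ring_embedding_inv:
  assumes h: "ring_embedding h" and b: "bij h"
  shows "ring_embedding (inv h)"
proof (rule ring_embeddingI)
  have hi: "h (inv h x) = x" for x by (rule surj_f_inv_f[OF bij_is_surj[OF b]])
  have ih: "inv h (h x) = x" for x by (rule inv_f_f[OF bij_is_inj[OF b]])
  show "inv h (p + q) = inv h p + inv h q" for p q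
    by (metis hi ih ring_embeddingD(1)[OF h])
  show "inv h (p * q) = inv h p * inv h q" for p q
    by (metis hi ih ring_embeddingD(2)[OF h])
  show "inv h 1 = 1" by (metis ih ring_embeddingD(3)[OF h])
  show "inv h p = 0 \<Longrightarrow> p = 0" for p by (metis hi ring_embeddingD(4)[OF h])
qed

lemma ring_embedding_funpow:
  fixes h :: "'a::comm_ring_1 \<Rightarrow> 'a"
  assumes "ring_embedding h"
  shows "ring_embedding (h ^^ n)"
proof (induction n)
  case 0
  show ?case by (simp add: ring_embedding_def)
next
  case (Suc n)
  show ?case using ring_embedding_comp[OF assms Suc] by (simp add: comp_def)
qed

lemma ring_embedding_int_iter:
  fixes h :: "'a::comm_ring_1 \<Rightarrow> 'a"
  assumes "ring_embedding h" "bij h"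
  shows "ring_embedding (int_iter h k)"
  using ring_embedding_funpow[OF assms(1)] ring_embedding_funpow[OF ring_embedding_inv[OF assms]]
  by (auto simp: int_iter_def)

lemma ring_embedding_shift: "ring_embedding (\<S> k l m)"
proof -
  note * = ring_embedding_int_iter[OF ring_embedding_shifts(1) bij_shifts(1), of k]
    ring_embedding_int_iter[OF ring_embedding_shifts(2) bij_shifts(2), of l]
    ring_embedding_int_iter[OF ring_embedding_shifts(3) bij_shifts(3), of m]
  have "\<S> k l m = (\<lambda>x. int_iter S\<^sub>a k (int_iter S\<^sub>b l (int_iter S\<^sub>c m x)))"
    by (rule ext) (rule shift_def)
  then show ?thesis
    using ring_embedding_comp[OF *(1) ring_embedding_comp[OF *(2,3)]] by simp
qed

lemma int_iter_fixed:
  assumes "bij f" "f x = x"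
  shows "int_iter f k x = x"
proof (induction k rule: int_iff_induct)
  case (2 k)
  show ?case
    unfolding int_iter_simps(3)[OF assms(1)] by (metis assms bij_pointE)
qed (simp add: int_iter_simps[OF assms(1)])

lemma int_iter_succ:
  assumes "bij f" "ring_embedding f" "f x = x + 1"
  shows "int_iter f k x = x + of_int k"
proof (induction k rule: int_iff_induct)
  case (2 k)
  have "f (x + of_int k) = x + of_int (k + 1)"
    by (simp add: ring_embeddingD[OF assms(2)] assms(3) ring_embedding_of_int[OF assms(2)])
  then show ?case
    unfolding int_iter_simps(3)[OF assms(1)] by (metis assms(1) bij_pointE)
qed (simp add: int_iter_simps[OF assms(1)])

lemma int_iter_commute:
  assumes "bij f" "\<And>x. f (g x) = g (f x)"
  shows "int_iter f k (g x) = g (int_iter f k x)"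
proof (induction k rule: int_iff_induct)
  case (2 k)
  show ?case
    unfolding int_iter_simps(3)[OF assms(1)] by (metis assms bij_pointE)
qed (simp add: int_iter_simps[OF assms(1)])

lemma shift_vars:
  "\<S> k l m \<^bold>a = \<^bold>a + of_int k" "\<S> k l m \<^bold>b = \<^bold>b + of_int l"
  "\<S> k l m \<^bold>c = \<^bold>c + of_int m" "\<S> k l m \<^bold>z = \<^bold>z"
  by (simp_all add: shift_def shift_variables int_iter_fixed[OF bij_shifts(1)]
      int_iter_fixed[OF bij_shifts(2)] int_iter_fixed[OF bij_shifts(3)]
      int_iter_succ[OF bij_shifts(1) ring_embedding_shifts(1)]
      int_iter_succ[OF bij_shifts(2) ring_embedding_shifts(2)]
      int_iter_succ[OF bij_shifts(3) ring_embedding_shifts(3)]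
      ring_embeddingD[OF ring_embedding_int_iter[OF ring_embedding_shifts(1) bij_shifts(1)]]
      ring_embeddingD[OF ring_embedding_int_iter[OF ring_embedding_shifts(2) bij_shifts(2)]]
      ring_embedding_of_int[OF ring_embedding_int_iter[OF ring_embedding_shifts(1) bij_shifts(1)]]
      ring_embedding_of_int[OF ring_embedding_int_iter[OF ring_embedding_shifts(2) bij_shifts(2)]])

lemma shift_100: "\<S> 1 0 0 x = S\<^sub>a x"
  by (simp add: shift_def int_iter_simps[OF bij_shifts(1)] int_iter_simps[OF bij_shifts(2)]
      int_iter_simps[OF bij_shifts(3)])

lemma shift_lift_shift_lift:
  assumes s: "ring_embedding \<sigma>" and t: "ring_embedding \<tau>"
  shows "shift_lift \<sigma> (shift_lift \<tau> x) = shift_lift (\<lambda>p. \<sigma> (\<tau> p)) x"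
proof -
  note s' = ring_embedding_coeff_shift[OF s] and t' = ring_embedding_coeff_shift[OF t]
    and st' = ring_embedding_coeff_shift[OF ring_embedding_comp[OF s t]]
  have "coeff_shift \<sigma> (coeff_shift \<tau> y) = coeff_shift (\<lambda>p. \<sigma> (\<tau> p)) y" for y
    by (rule fract_lift_fract_lift[OF ring_embedding_comp[OF ring_embedding_to_fract s] t])
  then have "map_poly (coeff_shift \<sigma>) (map_poly (coeff_shift \<tau>) p) =
      map_poly (coeff_shift (\<lambda>p. \<sigma> (\<tau> p))) p" for p
    by (intro poly_eqI)
      (simp add: coeff_map_poly ring_embeddingD[OF s'] ring_embeddingD[OF t'] ring_embeddingD[OF st'])
  then show ?thesis
    unfolding shift_lift_def
    by (simp add: fract_lift_fract_lift[OF ring_embedding_comp[OF ring_embedding_to_fract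
          ring_embedding_map_poly[OF s']] ring_embedding_map_poly[OF t']])
qed

text \<open>The substituted polynomial x + 1 has coefficients 0 and 1 only, which every ring
  embedding fixes. This is why shifts in different variables commute.\<close>

lemma map_poly_pcompose_succ:
  fixes h :: "'r::idom \<Rightarrow> 's::idom"
  assumes h: "ring_embedding h"
  shows "map_poly h (pcompose p [:1, 1:]) = pcompose (map_poly h p) [:1, 1:]"
proof (induction p)
  case (pCons x p)
  note m = ring_embedding_map_poly[OF h]
  have "map_poly h [:1, 1:] = [:1, 1:]" "map_poly h [:x:] = [:h x:]"
    by (simp_all add: map_poly_pCons ring_embeddingD[OF h])
  then show ?case
    using pCons.IH by (simp only: pcompose_pCons map_poly_pCons ring_embeddingD[OF h] ring_embeddingD[OF m])
qed simp

lemma shift_a_commute: "S\<^sub>b (S\<^sub>a x) = S\<^sub>a (S\<^sub>b x)" "S\<^sub>c (S\<^sub>a x) = S\<^sub>a (S\<^sub>c x)"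
proof -
  note e0 = ring_embedding_pcompose[of 1]
  note e1 = ring_embedding_map_poly[OF e0]
  note e2 = ring_embedding_map_poly[OF e1]
  show "S\<^sub>b (S\<^sub>a x) = S\<^sub>a (S\<^sub>b x)"
    unfolding shift_a_def shift_b_def shift_lift_shift_lift[OF e1 e2] shift_lift_shift_lift[OF e2 e1]
    by (rule arg_cong[of _ _ "\<lambda>s. shift_lift s x"], rule ext, rule poly_eqI)
      (simp add: coeff_map_poly map_poly_pcompose_succ[OF e0] ring_embeddingD[OF e0])
  show "S\<^sub>c (S\<^sub>a x) = S\<^sub>a (S\<^sub>c x)"
    unfolding shift_a_def shift_c_def shift_lift_shift_lift[OF e0 e2] shift_lift_shift_lift[OF e2 e0]
    by (simp add: map_poly_pcompose_succ[OF e1])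
qed

text \<open>In \<S> the a-shift is outermost, so the inner \<open>S\<^sub>a\<close> has to be moved
  past the iterates in c and b. This produces the index k + 1 in the addition formula for
  \<open>Q\<close>.\<close>

lemma shift_shift_a: "\<S> k l m (S\<^sub>a x) = \<S> (k + 1) l m x"
proof -
  have "int_iter S\<^sub>c m (S\<^sub>a x) = S\<^sub>a (int_iter S\<^sub>c m x)"
    and "int_iter S\<^sub>b l (S\<^sub>a y) = S\<^sub>a (int_iter S\<^sub>b l y)"
    and "int_iter S\<^sub>a k (S\<^sub>a y) = S\<^sub>a (int_iter S\<^sub>a k y)" for y
    by (rule int_iter_commute, rule bij_shifts, simp only: shift_a_commute)+
  then show ?thesis
    unfolding shift_def by (simp only: int_iter_simps(3)[OF bij_shifts(1)])
qed

lemma hypF_shift: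
  assumes "\<^bold>F \<alpha> \<beta> \<gamma> = laurent p * \<^bold>F \<alpha>\<^sub>1 \<beta>\<^sub>1 \<gamma>\<^sub>1 + laurent q * \<^bold>F \<alpha>\<^sub>2 \<beta>\<^sub>2 \<gamma>\<^sub>2"
  shows "\<^bold>F (k + \<alpha>) (l + \<beta>) (m + \<gamma>) = laurent (\<S> k l m p) * \<^bold>F (k + \<alpha>\<^sub>1) (l + \<beta>\<^sub>1) (m + \<gamma>\<^sub>1)
    + laurent (\<S> k l m q) * \<^bold>F (k + \<alpha>\<^sub>2) (l + \<beta>\<^sub>2) (m + \<gamma>\<^sub>2)"
proof -
  \<comment> \<open>The equation is encoded as a vanishing three-term sum with coefficients -1, p,
    q; the shift leaves -1 unchanged.\<close>
  let ?h = "\<lambda>(n::nat) x y z. if n = 0 then x else if n = 1 then y else z"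
  have sum3: "(\<Sum>n\<in>{0,1,2}. f n) = 0 \<longleftrightarrow> - f 0 = f 1 + f (2::nat)" for f :: "nat \<Rightarrow> Cabc fls"
    by (simp add: neg_eq_iff_add_eq_0)
  note L = ring_embeddingD[OF ring_embedding_laurent] ring_embedding_uminus[OF ring_embedding_laurent]
    ring_embeddingD[OF ring_embedding_shift] ring_embedding_uminus[OF ring_embedding_shift]
  show ?thesis
    using relation_shift[where I = "{0,1,2}" and k = k and l = l and m = m and f = "\<lambda>n. ?h n (- 1) p q"
        and \<alpha> = "\<lambda>n. ?h n \<alpha> \<alpha>\<^sub>1 \<alpha>\<^sub>2" and \<beta> = "\<lambda>n. ?h n \<beta> \<beta>\<^sub>1 \<beta>\<^sub>2"
        and \<gamma> = "\<lambda>n. ?h n \<gamma> \<gamma>\<^sub>1 \<gamma>\<^sub>2"] assms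
    unfolding sum3 by (simp add: L)
qed

subsection \<open>Linear independence and contiguous relations\<close>

text \<open>The operator z d/dz + a multiplies the n-th coefficient by a + n. This turns linear
  relations between F(a) and F(a+1) into statements about F'/F.\<close>

lemma hypergeo_plus1_deriv:
  "fps_const a * hypergeo (a + 1) b c = fps_X * fps_deriv (hypergeo a b c) + fps_const a * hypergeo a b c"
proof (rule fps_ext)
  fix n
  show "(fps_const a * hypergeo (a + 1) b c) $ n =
    (fps_X * fps_deriv (hypergeo a b c) + fps_const a * hypergeo a b c) $ n"
    using hypergeo_nth_plus1(1)[of a b c n]
    by (cases n) (simp_all add: algebra_simps del: of_nat_Suc fps_hypergeo_nth)
qed

lemma hypergeo_independent:
  fixes P Q :: "'a::field_char_0 poly"
  assumes nz: "\<And>n. a + of_nat n \<noteq> 0" "\<And>n. b + of_nat n \<noteq> 0" "\<And>n. c + of_nat n \<noteq> 0"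
      "\<And>n. c - a + of_nat n \<noteq> 0" "\<And>n. c - b + of_nat n \<noteq> 0"
    and rel: "fps_of_poly P * hypergeo a b c + fps_of_poly Q * hypergeo (a + 1) b c = 0"
  shows "P = 0 \<and> Q = 0"
proof -
  let ?p = "fps_of_poly" and ?F = "hypergeo a b c"
  have F0: "?F $ 0 \<noteq> 0" by simp
  \<comment> \<open>Multiplying the relation by a and replacing a F(a+1) by z F' + a F gives z Q F'
    = - a (P + Q) F.\<close>
  have "?p (Q * [:0, 1:]) * fps_deriv ?F = ?p (- (smult a (P + Q))) * ?F"
  proof -
    have "?p [:0, 1:] = (fps_X :: 'a fps)" by (simp add: fps_of_poly_pCons)
    moreover have "q * x * f' = - (k * (p + q)) * f" if "p * f + q * g = 0" "k * g = x * f' + k * f"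
      for f f' g k p q x :: "'a fps"
      using that by algebra
    ultimately show ?thesis
      using rel hypergeo_plus1_deriv[of a b c]
      unfolding fps_of_poly_mult fps_of_poly_uminus fps_of_poly_smult fps_of_poly_add by metis
  qed
  then have "Q * [:0, 1:] = 0"
    by (rule hypergeo_logderiv_irrational[OF F0 hypergeo_ode[OF nz(3)] nz(1,2,4,5)])
  then have "Q = 0" by simp
  moreover have "?F \<noteq> 0" using F0 by force
  ultimately show ?thesis using rel by simp
qed

lemma hypF_independent:
  assumes rel: "laurent p * \<^bold>F 0 0 0 + laurent q * \<^bold>F 1 0 0 = 0"
  shows "p = 0 \<and> q = 0"
proof -
  let ?f = "\<lambda>r. fps_to_fls (fps_of_poly r)"
  obtain p1 p2 where p: "p = Fract p1 p2" "p2 \<noteq> 0" by (cases p)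
  obtain q1 q2 where q: "q = Fract q1 q2" "q2 \<noteq> 0" by (cases q)
  have nz: "?f p2 \<noteq> 0" "?f q2 \<noteq> 0" using p q by simp_all
  have "?f p1 / ?f p2 * \<^bold>F 0 0 0 + ?f q1 / ?f q2 * \<^bold>F 1 0 0 = 0"
    using rel p q by (simp add: laurent_Fract)
  moreover have "x1 * y2 * f + y1 * x2 * g = 0"
    if "x1 / x2 * f + y1 / y2 * g = 0" "x2 \<noteq> 0" "y2 \<noteq> 0" for x1 x2 y1 y2 f g :: "Cabc fls"
    using that by (simp add: field_simps)
  ultimately have "?f p1 * ?f q2 * \<^bold>F 0 0 0 + ?f q1 * ?f p2 * \<^bold>F 1 0 0 = 0"
    using nz by metis
  then have "fps_to_fls (fps_of_poly (p1 * q2) * hypergeo par_a par_b par_c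
      + fps_of_poly (q1 * p2) * hypergeo (par_a + 1) par_b par_c) = 0"
    by (simp add: hypF_def fls_times_fps_to_fls fps_of_poly_mult)
  then have "fps_of_poly (p1 * q2) * hypergeo par_a par_b par_c
      + fps_of_poly (q1 * p2) * hypergeo (par_a + 1) par_b par_c = 0"
    by (simp only: fps_to_fls_eq_0_iff)
  moreover have nz': "par_a + of_nat n \<noteq> 0" "par_b + of_nat n \<noteq> 0" "par_c + of_nat n \<noteq> 0"
    "par_c - par_a + of_nat n \<noteq> 0" "par_c - par_b + of_nat n \<noteq> 0" for n
    using param_nonzero[of "int n"] by simp_all
  ultimately have "p1 * q2 = 0 \<and> q1 * p2 = 0"
    using hypergeo_independent[OF nz'] by blast
  then show ?thesis using p q by (simp add: fract_collapse)
qed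

text \<open>Every neighbour has coefficients that are rational multiples of those of F, so with the
  recurrence each relation becomes an identity of rational functions of a, b, c and n.\<close>

lemma hypergeo_contiguous:
  fixes a b c :: "'a::field_char_0"
  assumes nz: "a \<noteq> 0" "\<And>n. c + of_nat n \<noteq> 0"
  shows "fps_const (c - a - 1) * hypergeo a b c
      + (fps_const (2 * a + 2 - c) + fps_const (b - a - 1) * fps_X) * hypergeo (a + 1) b c
      + fps_const (a + 1) * (fps_X - 1) * hypergeo (a + 1 + 1) b c = 0"
    and "fps_const b * (hypergeo a (b + 1) c - hypergeo a b c)
      = fps_const a * (hypergeo (a + 1) b c - hypergeo a b c)"
    and "fps_const ((c - a) * (c - b)) * fps_X * hypergeo a b (c + 1)
      = fps_const c * (fps_const a * (1 - fps_X) * hypergeo (a + 1) b c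
        + (fps_const (c - b) * fps_X - fps_const a) * hypergeo a b c)"
    and "fps_const a * (hypergeo (a + 1) b (c + 1) - hypergeo a b (c + 1))
      = fps_const c * (hypergeo a b c - hypergeo a b (c + 1))"
proof -
  note cs = hypergeo_nth_plus1(1)[of a b c] hypergeo_nth_plus1(2)[of b a c]
    hypergeo_nth_plus1(1)[of "a + 1" b c]
    hypergeo_nth_plus1(1)[of a b "c + 1"] hypergeo_nth_c[OF nz(2), of _ a b]
    hypergeo_nth_Suc[OF nz(2), of _ a b]
  define u v w t s r where "u = hypergeo a b c" and "v = hypergeo (a + 1) b c"
    and "w = hypergeo (a + 1 + 1) b c" and "t = hypergeo a (b + 1) c"
    and "s = hypergeo a b (c + 1)" and "r = hypergeo (a + 1) b (c + 1)"
  note d = u_def[symmetric] v_def[symmetric] w_def[symmetric] t_def[symmetric] s_def[symmetric] r_def[symmetric]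
  note cs = cs[unfolded d]
  have 0: "u $ 0 = 1" "v $ 0 = 1" "w $ 0 = 1" "t $ 0 = 1" "s $ 0 = 1" "r $ 0 = 1"
    unfolding u_def v_def w_def t_def s_def r_def by simp_all
  have v: "v $ n = (a + of_nat n) * u $ n / a" for n
    using cs(1)[of n] nz(1) by (simp add: field_simps)
  have u: "u $ Suc n = (a + of_nat n) * (b + of_nat n) * u $ n / ((c + of_nat n) * of_nat (Suc n))" for n
    using cs(6)[of n] nz(2)[of n] by (simp add: eq_divide_eq mult_ac del: of_nat_Suc)
  have s: "s $ n = c * u $ n / (c + of_nat n)" for n
    using cs(5)[of n] nz(2)[of n] by (simp add: field_simps)
  show "fps_const (c - a - 1) * hypergeo a b c
      + (fps_const (2 * a + 2 - c) + fps_const (b - a - 1) * fps_X) * hypergeo (a + 1) b c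
      + fps_const (a + 1) * (fps_X - 1) * hypergeo (a + 1 + 1) b c = 0"
    unfolding d
  proof (rule fps_ext)
    fix n
    \<comment> \<open>Regrouping puts the terms containing z behind a single factor, so coefficient
      k + 1 involves only indices k and k + 1.\<close>
    have E: "fps_const (c - a - 1) * u
      + (fps_const (2 * a + 2 - c) + fps_const (b - a - 1) * fps_X) * v
      + fps_const (a + 1) * (fps_X - 1) * w = 
      fps_const (c - a - 1) * u + fps_const (2 * a + 2 - c) * v - fps_const (a + 1) * w
       + fps_X * (fps_const (b - a - 1) * v + fps_const (a + 1) * w)"
      by algebra
    show "(fps_const (c - a - 1) * u
      + (fps_const (2 * a + 2 - c) + fps_const (b - a - 1) * fps_X) * v
      + fps_const (a + 1) * (fps_X - 1) * w) $ n = 0 $ n"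
      unfolding E
    proof (cases n)
      case (Suc k)
      have *: "(a + 1) * w $ i = (a + 1 + of_nat i) * v $ i" for i by (rule cs(3))
      have "c + of_nat k \<noteq> 0" "of_nat (Suc k) \<noteq> (0::'a)" "a \<noteq> 0" using nz by (simp_all del: of_nat_Suc)
      then have "(c - a - 1) * u $ Suc k + (2 * a + 2 - c) * v $ Suc k - (a + 1 + of_nat (Suc k)) * v $ Suc k
        + ((b - a - 1) * v $ k + (a + 1 + of_nat k) * v $ k) = 0"
        unfolding v u by (simp add: divide_simps del: of_nat_Suc) (simp add: algebra_simps)
      then show "(fps_const (c - a - 1) * u + fps_const (2 * a + 2 - c) * v - fps_const (a + 1) * w
       + fps_X * (fps_const (b - a - 1) * v + fps_const (a + 1) * w)) $ n = 0 $ n"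
        using Suc by (simp add: * del: of_nat_Suc)
    qed (simp add: 0)
  qed
  show "fps_const b * (hypergeo a (b + 1) c - hypergeo a b c)
      = fps_const a * (hypergeo (a + 1) b c - hypergeo a b c)"
    unfolding d by (rule fps_ext) (simp add: right_diff_distrib cs(1,2), simp add: algebra_simps)
  show "fps_const a * (hypergeo (a + 1) b (c + 1) - hypergeo a b (c + 1))
      = fps_const c * (hypergeo a b c - hypergeo a b (c + 1))"
    unfolding d
    by (rule fps_ext) (simp add: right_diff_distrib cs(4), simp add: cs(5)[symmetric] algebra_simps)
  show "fps_const ((c - a) * (c - b)) * fps_X * hypergeo a b (c + 1)
      = fps_const c * (fps_const a * (1 - fps_X) * hypergeo (a + 1) b c
        + (fps_const (c - b) * fps_X - fps_const a) * hypergeo a b c)"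
    unfolding d
  proof (rule fps_ext)
    fix n
    have E: "fps_const c * (fps_const a * (1 - fps_X) * v + (fps_const (c - b) * fps_X - fps_const a) * u)
      = fps_const c * (fps_const a * v - fps_const a * u)
        + fps_X * (fps_const c * (fps_const (c - b) * u - fps_const a * v))"
      by algebra
    have E': "fps_const ((c - a) * (c - b)) * fps_X * s = fps_X * (fps_const ((c - a) * (c - b)) * s)"
      by algebra
    show "(fps_const ((c - a) * (c - b)) * fps_X * s) $ n
      = (fps_const c * (fps_const a * (1 - fps_X) * v + (fps_const (c - b) * fps_X - fps_const a) * u)) $ n"
      unfolding E E'
    proof (cases n)
      case (Suc k)
      have "c + of_nat k \<noteq> 0" "of_nat (Suc k) \<noteq> (0::'a)" "a \<noteq> 0" using nz by (simp_all del: of_nat_Suc)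
      then have "(c - a) * (c - b) * s $ k = c * (a * v $ Suc k - a * u $ Suc k)
        + c * ((c - b) * u $ k - a * v $ k)"
        unfolding v u s by (simp add: divide_simps del: of_nat_Suc) (simp add: algebra_simps)
      then show "(fps_X * (fps_const ((c - a) * (c - b)) * s)) $ n = (fps_const c * (fps_const a * v - fps_const a * u)
        + fps_X * (fps_const c * (fps_const (c - b) * u - fps_const a * v))) $ n"
        using Suc by (simp del: of_nat_Suc)
    qed (simp add: 0)
  qed
qed

lemma ring_embedding_numeral: "ring_embedding h \<Longrightarrow> h (numeral n) = numeral n"
  using ring_embedding_of_nat[of h "numeral n"] by simp

lemma ring_embedding_const: "ring_embedding (\<lambda>x :: Cabc. to_fract [:x:])"
  by (rule ring_embeddingI) (simp_all flip: to_fract_mult to_fract_add one_pCons)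

lemma var_nonzero:
  "\<^bold>a + of_int n \<noteq> 0" "\<^bold>b + of_int n \<noteq> 0" "\<^bold>c + of_int n \<noteq> 0"
  "\<^bold>c - \<^bold>a + of_int n \<noteq> 0" "\<^bold>c - \<^bold>b + of_int n \<noteq> 0" "\<^bold>z \<noteq> 0" "1 - \<^bold>z \<noteq> 0" "\<^bold>z - 1 \<noteq> 0"
proof -
  note e = ring_embedding_const
  note e' = ring_embeddingD[OF e] ring_embedding_diff[OF e] ring_embedding_of_int[OF e]
  have "to_fract [:x:] \<noteq> (0 :: Cabcz)" if "x \<noteq> 0" for x
    using that by simp
  from this[OF param_nonzero(1)] this[OF param_nonzero(2)] this[OF param_nonzero(3)]
    this[OF param_nonzero(4)] this[OF param_nonzero(5)]
  show "\<^bold>a + of_int n \<noteq> 0" "\<^bold>b + of_int n \<noteq> 0" "\<^bold>c + of_int n \<noteq> 0"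
    "\<^bold>c - \<^bold>a + of_int n \<noteq> 0" "\<^bold>c - \<^bold>b + of_int n \<noteq> 0"
    unfolding e' var_a_def var_b_def var_c_def by blast+
  show "\<^bold>z \<noteq> 0" by (simp add: var_z_def)
  have "\<^bold>z - 1 = to_fract ([:0, 1:] - 1)" unfolding var_z_def by simp
  also have "\<dots> \<noteq> 0" by (simp add: one_pCons)
  finally show "\<^bold>z - 1 \<noteq> 0" .
  then show "1 - \<^bold>z \<noteq> 0" by simp
qed

lemma laurent_vars:
  "laurent \<^bold>a = fls_const par_a" "laurent \<^bold>b = fls_const par_b" "laurent \<^bold>c = fls_const par_c"
  "laurent \<^bold>z = fls_X"
  by (simp_all add: var_a_def var_b_def var_c_def var_z_def laurent_to_fract fps_of_poly_pCons)

lemma hypF_contiguous: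
  "laurent ((\<^bold>a + 1) * (1 - \<^bold>z)) * \<^bold>F 2 0 0 =
    laurent (\<^bold>c - \<^bold>a - 1) * \<^bold>F 0 0 0 + laurent (2 * \<^bold>a + 2 - \<^bold>c + (\<^bold>b - \<^bold>a - 1) * \<^bold>z) * \<^bold>F 1 0 0"
  "laurent \<^bold>b * \<^bold>F 0 1 0 = laurent (\<^bold>b - \<^bold>a) * \<^bold>F 0 0 0 + laurent \<^bold>a * \<^bold>F 1 0 0"
  "laurent ((\<^bold>c - \<^bold>a) * (\<^bold>c - \<^bold>b) * \<^bold>z) * \<^bold>F 0 0 1 =
    laurent (\<^bold>c * ((\<^bold>c - \<^bold>b) * \<^bold>z - \<^bold>a)) * \<^bold>F 0 0 0 + laurent (\<^bold>c * \<^bold>a * (1 - \<^bold>z)) * \<^bold>F 1 0 0"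
  "laurent \<^bold>a * \<^bold>F 1 0 1 = laurent \<^bold>c * \<^bold>F 0 0 0 + laurent (\<^bold>a - \<^bold>c) * \<^bold>F 0 0 1"
proof -
  have nz: "par_a \<noteq> 0" "par_c + of_nat n \<noteq> 0" for n
    using param_nonzero(1)[of 0] param_nonzero(3)[of "int n"] by simp_all
  have e: "ring_embedding (fls_const :: Cabc \<Rightarrow> _)"
    by (rule ring_embeddingI) (simp_all add: fls_plus_const)
  note L = ring_embeddingD[OF ring_embedding_laurent] ring_embedding_diff[OF ring_embedding_laurent]
    ring_embedding_numeral[OF ring_embedding_laurent] laurent_vars
  note K = ring_embeddingD(1-3)[OF e] ring_embedding_diff[OF e] ring_embedding_numeral[OF e]
  note T = fls_times_fps_to_fls fps_to_fls_plus fps_to_fls_minus fps_const_to_fls fps_X_to_fls fps_one_to_fls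
    fps_zero_to_fls
  have two: "par_a + 2 = par_a + 1 + 1" by simp
  have F: "\<^bold>F 0 0 0 = fps_to_fls (hypergeo par_a par_b par_c)"
    "\<^bold>F 1 0 0 = fps_to_fls (hypergeo (par_a + 1) par_b par_c)"
    "\<^bold>F 2 0 0 = fps_to_fls (hypergeo (par_a + 1 + 1) par_b par_c)"
    "\<^bold>F 0 1 0 = fps_to_fls (hypergeo par_a (par_b + 1) par_c)"
    "\<^bold>F 0 0 1 = fps_to_fls (hypergeo par_a par_b (par_c + 1))"
    "\<^bold>F 1 0 1 = fps_to_fls (hypergeo (par_a + 1) par_b (par_c + 1))"
    unfolding hypF_def two[symmetric] by simp_all
  note R = hypergeo_contiguous[OF nz, of par_b, THEN arg_cong[of _ _ fps_to_fls], unfolded T F[symmetric] K]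
  show "laurent ((\<^bold>a + 1) * (1 - \<^bold>z)) * \<^bold>F 2 0 0 =
    laurent (\<^bold>c - \<^bold>a - 1) * \<^bold>F 0 0 0 + laurent (2 * \<^bold>a + 2 - \<^bold>c + (\<^bold>b - \<^bold>a - 1) * \<^bold>z) * \<^bold>F 1 0 0"
    unfolding L using R(1) by algebra
  show "laurent \<^bold>b * \<^bold>F 0 1 0 = laurent (\<^bold>b - \<^bold>a) * \<^bold>F 0 0 0 + laurent \<^bold>a * \<^bold>F 1 0 0"
    unfolding L using R(2) by algebra
  show "laurent ((\<^bold>c - \<^bold>a) * (\<^bold>c - \<^bold>b) * \<^bold>z) * \<^bold>F 0 0 1 =
    laurent (\<^bold>c * ((\<^bold>c - \<^bold>b) * \<^bold>z - \<^bold>a)) * \<^bold>F 0 0 0 + laurent (\<^bold>c * \<^bold>a * (1 - \<^bold>z)) * \<^bold>F 1 0 0"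
    unfolding L using R(3) by algebra
  show "laurent \<^bold>a * \<^bold>F 1 0 1 = laurent \<^bold>c * \<^bold>F 0 0 0 + laurent (\<^bold>a - \<^bold>c) * \<^bold>F 0 0 1"
    unfolding L using R(4) by algebra
qed

lemma laurent_solve:
  assumes "laurent d * x = laurent p * u + laurent q * v" "d \<noteq> 0"
  shows "x = laurent (p / d) * u + laurent (q / d) * v"
proof -
  have "laurent d \<noteq> 0" using assms(2) by (simp add: ring_embeddingD[OF ring_embedding_laurent])
  then show ?thesis
    using assms(1) by (simp add: ring_embedding_divide[OF ring_embedding_laurent] field_simps)
qed

subsection \<open>Transition matrices and their determinants\<close>

text \<open>The change-of-basis matrix is hidden behind an existential and only its determinant is
  recorded. Steps can thus be composed and inverted before the matrix entries are known to be
  unique.\<close>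

definition frame :: "Cabc fls \<Rightarrow> Cabc fls \<Rightarrow> Cabc fls \<Rightarrow> Cabc fls \<Rightarrow> Cabcz \<Rightarrow> bool" where
  "frame u v u' v' w \<longleftrightarrow> (\<exists>p\<^sub>1 q\<^sub>1 p\<^sub>2 q\<^sub>2. u' = laurent p\<^sub>1 * u + laurent q\<^sub>1 * v \<and>
     v' = laurent p\<^sub>2 * u + laurent q\<^sub>2 * v \<and> p\<^sub>1 * q\<^sub>2 - p\<^sub>2 * q\<^sub>1 = w)"

lemma frame_refl: "frame u v u v 1"
  unfolding frame_def
  by (rule exI[of _ 1], rule exI[of _ 0], rule exI[of _ 0], rule exI[of _ 1])
    (simp add: ring_embeddingD[OF ring_embedding_laurent])

lemma frame_trans:
  assumes "frame u v u' v' w" "frame u' v' u'' v'' w'"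
  shows "frame u v u'' v'' (w * w')"
proof -
  obtain p1 q1 p2 q2 where 1: "u' = laurent p1 * u + laurent q1 * v"
    "v' = laurent p2 * u + laurent q2 * v" "p1 * q2 - p2 * q1 = w"
    using assms(1) unfolding frame_def by blast
  obtain r1 s1 r2 s2 where 2: "u'' = laurent r1 * u' + laurent s1 * v'"
    "v'' = laurent r2 * u' + laurent s2 * v'" "r1 * s2 - r2 * s1 = w'"
    using assms(2) unfolding frame_def by blast
  show ?thesis
    unfolding frame_def
    by (rule exI[of _ "r1 * p1 + s1 * p2"], rule exI[of _ "r1 * q1 + s1 * q2"],
        rule exI[of _ "r2 * p1 + s2 * p2"], rule exI[of _ "r2 * q1 + s2 * q2"])
      (simp add: 1(1,2) 2(1,2) 1(3)[symmetric] 2(3)[symmetric]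
        ring_embeddingD[OF ring_embedding_laurent] algebra_simps)
qed

lemma frame_inv:
  assumes "frame u v u' v' w" "w \<noteq> 0"
  shows "frame u' v' u v (1 / w)"
proof -
  obtain p1 q1 p2 q2 where 1: "u' = laurent p1 * u + laurent q1 * v"
    "v' = laurent p2 * u + laurent q2 * v" "p1 * q2 - p2 * q1 = w"
    using assms(1) unfolding frame_def by blast
  note L = ring_embeddingD[OF ring_embedding_laurent] ring_embedding_diff[OF ring_embedding_laurent]
    ring_embedding_uminus[OF ring_embedding_laurent]
  have w: "laurent p1 * laurent q2 - laurent p2 * laurent q1 = laurent w"
    using 1(3) by (simp add: L flip: 1(3))
  \<comment> \<open>Cramer's rule: the inverse matrix is the adjugate divided by
    \<open>w\<close>.\<close>
  have "laurent w * u = laurent q2 * u' + laurent (- q1) * v'"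
    "laurent w * v = laurent (- p2) * u' + laurent p1 * v'"
    unfolding L using 1(1,2) w by algebra+
  note this[THEN laurent_solve[OF _ assms(2)]]
  moreover have "(q2 / w) * (p1 / w) - (- p2 / w) * (- q1 / w) = 1 / w"
    using assms(2) 1(3) by (simp add: divide_simps) algebra
  ultimately show ?thesis unfolding frame_def by blast
qed

lemma frame_shift:
  assumes "frame (\<^bold>F 0 0 0) (\<^bold>F 1 0 0) (\<^bold>F i j n) (\<^bold>F (i + 1) j n) w"
  shows "frame (\<^bold>F k l m) (\<^bold>F (k + 1) l m) (\<^bold>F (k + i) (l + j) (m + n))
    (\<^bold>F (k + i + 1) (l + j) (m + n)) (\<S> k l m w)"
proof -
  obtain p1 q1 p2 q2 where 1: "\<^bold>F i j n = laurent p1 * \<^bold>F 0 0 0 + laurent q1 * \<^bold>F 1 0 0"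
    "\<^bold>F (i + 1) j n = laurent p2 * \<^bold>F 0 0 0 + laurent q2 * \<^bold>F 1 0 0" "p1 * q2 - p2 * q1 = w"
    using assms(1) unfolding frame_def by blast
  have "\<S> k l m p1 * \<S> k l m q2 - \<S> k l m p2 * \<S> k l m q1 = \<S> k l m w"
    by (simp add: ring_embeddingD[OF ring_embedding_shift] ring_embedding_diff[OF ring_embedding_shift]
        flip: 1(3))
  then show ?thesis
    using hypF_shift[OF 1(1), of k l m] hypF_shift[OF 1(2), of k l m]
    unfolding frame_def by (auto simp: add.assoc)
qed

lemma frame_step:
  "frame (\<^bold>F 0 0 0) (\<^bold>F 1 0 0) (\<^bold>F 1 0 0) (\<^bold>F 2 0 0) ((\<^bold>c - \<^bold>a - 1) / ((\<^bold>a + 1) * (\<^bold>z - 1)))"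
  "frame (\<^bold>F 0 0 0) (\<^bold>F 1 0 0) (\<^bold>F 0 1 0) (\<^bold>F 1 1 0) ((\<^bold>c - \<^bold>b - 1) / (\<^bold>b * (\<^bold>z - 1)))"
  "frame (\<^bold>F 0 0 0) (\<^bold>F 1 0 0) (\<^bold>F 0 0 1) (\<^bold>F 1 0 1)
     (\<^bold>c\<^sup>2 * (\<^bold>z - 1) / ((\<^bold>c - \<^bold>a) * (\<^bold>c - \<^bold>b) * \<^bold>z))"
proof -
  note L = ring_embeddingD[OF ring_embedding_laurent]
  note nz = var_nonzero(1)[of 1, simplified] var_nonzero(1-5)[of 0, simplified] var_nonzero(6-8)
  define pa qa where "pa = (\<^bold>c - \<^bold>a - 1) / ((\<^bold>a + 1) * (1 - \<^bold>z))"
    and "qa = (2 * \<^bold>a + 2 - \<^bold>c + (\<^bold>b - \<^bold>a - 1) * \<^bold>z) / ((\<^bold>a + 1) * (1 - \<^bold>z))"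
  have 200: "\<^bold>F 2 0 0 = laurent pa * \<^bold>F 0 0 0 + laurent qa * \<^bold>F 1 0 0"
    unfolding pa_def qa_def by (rule laurent_solve[OF hypF_contiguous(1)]) (use nz in simp)
  have 010: "\<^bold>F 0 1 0 = laurent ((\<^bold>b - \<^bold>a) / \<^bold>b) * \<^bold>F 0 0 0 + laurent (\<^bold>a / \<^bold>b) * \<^bold>F 1 0 0"
    by (rule laurent_solve[OF hypF_contiguous(2)]) (use nz in simp)
  \<comment> \<open>The second row of the b-step is the a-shift of the first; F(a+2) is then
    eliminated with the three-term relation in a.\<close>
  have "\<^bold>F 1 1 0 = laurent ((\<^bold>b - \<^bold>a - 1) / \<^bold>b) * \<^bold>F 1 0 0 + laurent ((\<^bold>a + 1) / \<^bold>b) * \<^bold>F 2 0 0"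
    using hypF_shift[OF 010, of 1 0 0] ring_embedding_shift[of 1 0 0]
    by (simp add: ring_embedding_divide ring_embedding_diff shift_vars diff_diff_eq)
  then have 110: "\<^bold>F 1 1 0 = laurent ((\<^bold>a + 1) / \<^bold>b * pa) * \<^bold>F 0 0 0
      + laurent ((\<^bold>b - \<^bold>a - 1) / \<^bold>b + (\<^bold>a + 1) / \<^bold>b * qa) * \<^bold>F 1 0 0"
    unfolding 200 L by algebra
  define pc qc where "pc = \<^bold>c * ((\<^bold>c - \<^bold>b) * \<^bold>z - \<^bold>a) / ((\<^bold>c - \<^bold>a) * (\<^bold>c - \<^bold>b) * \<^bold>z)"
    and "qc = \<^bold>c * \<^bold>a * (1 - \<^bold>z) / ((\<^bold>c - \<^bold>a) * (\<^bold>c - \<^bold>b) * \<^bold>z)"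
  have 001: "\<^bold>F 0 0 1 = laurent pc * \<^bold>F 0 0 0 + laurent qc * \<^bold>F 1 0 0"
    unfolding pc_def qc_def by (rule laurent_solve[OF hypF_contiguous(3)]) (use nz in simp)
  have "\<^bold>F 1 0 1 = laurent (\<^bold>c / \<^bold>a) * \<^bold>F 0 0 0 + laurent ((\<^bold>a - \<^bold>c) / \<^bold>a) * \<^bold>F 0 0 1"
    by (rule laurent_solve[OF hypF_contiguous(4)]) (use nz in simp)
  then have 101: "\<^bold>F 1 0 1 = laurent (\<^bold>c / \<^bold>a + (\<^bold>a - \<^bold>c) / \<^bold>a * pc) * \<^bold>F 0 0 0
      + laurent ((\<^bold>a - \<^bold>c) / \<^bold>a * qc) * \<^bold>F 1 0 0"
    unfolding 001 L by algebra
  have 100: "\<^bold>F 1 0 0 = laurent 0 * \<^bold>F 0 0 0 + laurent 1 * \<^bold>F 1 0 0"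
    by (simp add: L)
  have z: "1 - \<^bold>z = - (\<^bold>z - 1)" by simp
  have "0 * qa - pa * 1 = (\<^bold>c - \<^bold>a - 1) / ((\<^bold>a + 1) * (\<^bold>z - 1))"
    unfolding pa_def z by (simp only: mult_minus_right divide_minus_right) simp
  then show "frame (\<^bold>F 0 0 0) (\<^bold>F 1 0 0) (\<^bold>F 1 0 0) (\<^bold>F 2 0 0) ((\<^bold>c - \<^bold>a - 1) / ((\<^bold>a + 1) * (\<^bold>z - 1)))"
    unfolding frame_def using 100 200 by blast
  have "(b - a) / b * ((b - a - 1) / b + (a + 1) / b * ((2 * a + 2 - c + (b - a - 1) * z) / ((a + 1) * (1 - z))))
     - (a + 1) / b * ((c - a - 1) / ((a + 1) * (1 - z))) * (a / b) = (c - b - 1) / (b * (z - 1))"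
    if "b \<noteq> 0" "a + 1 \<noteq> 0" "z - 1 \<noteq> 0" for a b c z :: Cabcz
  proof -
    have z: "1 - z = - (z - 1)" by simp
    \<comment> \<open>With \<open>y\<close> as variable, 1 - z and z - 1 become the same denominator
      up to sign.\<close>
    define y where "y = z - 1"
    have z': "z = y + 1" by (simp add: y_def)
    show ?thesis
      unfolding z y_def[symmetric] unfolding z' using that[folded y_def]
      by (simp add: divide_simps) algebra
  qed
  then have "(\<^bold>b - \<^bold>a) / \<^bold>b * ((\<^bold>b - \<^bold>a - 1) / \<^bold>b + (\<^bold>a + 1) / \<^bold>b * qa)
     - (\<^bold>a + 1) / \<^bold>b * pa * (\<^bold>a / \<^bold>b) = (\<^bold>c - \<^bold>b - 1) / (\<^bold>b * (\<^bold>z - 1))"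
    unfolding pa_def qa_def using nz by blast
  then show "frame (\<^bold>F 0 0 0) (\<^bold>F 1 0 0) (\<^bold>F 0 1 0) (\<^bold>F 1 1 0) ((\<^bold>c - \<^bold>b - 1) / (\<^bold>b * (\<^bold>z - 1)))"
    unfolding frame_def using 010 110 by blast
  \<comment> \<open>The second row is a multiple of the first plus (c/a, 0), so only - (c/a) times
    \<open>qc\<close> survives.\<close>
  have "pc * ((\<^bold>a - \<^bold>c) / \<^bold>a * qc) - (\<^bold>c / \<^bold>a + (\<^bold>a - \<^bold>c) / \<^bold>a * pc) * qc = - \<^bold>c / \<^bold>a * qc"
    by algebra
  also have "\<dots> = \<^bold>c\<^sup>2 * (\<^bold>z - 1) / ((\<^bold>c - \<^bold>a) * (\<^bold>c - \<^bold>b) * \<^bold>z)"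
    unfolding qc_def using nz by (simp add: divide_simps) algebra
  finally show "frame (\<^bold>F 0 0 0) (\<^bold>F 1 0 0) (\<^bold>F 0 0 1) (\<^bold>F 1 0 1)
     (\<^bold>c\<^sup>2 * (\<^bold>z - 1) / ((\<^bold>c - \<^bold>a) * (\<^bold>c - \<^bold>b) * \<^bold>z))"
    unfolding frame_def using 001 101 by blast
qed

section \<open>Integer-index Pochhammer symbols and the determinant in closed form\<close>

lemma pochhammer_int_Suc:
  fixes x :: "'f::field_char_0"
  assumes "\<And>n. x + of_int n \<noteq> 0"
  shows "pochhammer_int x (k + 1) = pochhammer_int x k * (x + of_int k)"
proof (cases "k \<ge> 0")
  case True
  then show ?thesis
    by (simp add: pochhammer_int_def nat_add_distrib pochhammer_Suc)
next
  case False
  define j where "j = nat (- (k + 1))"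
  have j: "nat (- k) = Suc j" "k = - int (Suc j)" using False by (auto simp: j_def)
  have eq: "x + of_int k = x - of_nat (Suc j)" using j(2) by simp
  moreover have "x - of_nat (Suc j) \<noteq> 0" using assms[of k] unfolding eq .
  \<comment> \<open>For negative k the factor x + k is the last one of the product in the
    denominator and cancels.\<close>
  ultimately have "pochhammer_int x k * (x + of_int k) = 1 / (\<Prod>i=1..j. x - of_nat i)"
    using False by (simp add: pochhammer_int_def j(1) del: of_nat_Suc)
  also have "\<dots> = pochhammer_int x (k + 1)"
    using False by (cases "k = - 1") (auto simp: pochhammer_int_def j_def)
  finally show ?thesis ..
qed

lemma pochhammer_int_nonzero:
  fixes x :: "'f::field_char_0"
  assumes "\<And>n. x + of_int n \<noteq> 0"
  shows "pochhammer_int x k \<noteq> 0"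
  by (induction k rule: int_iff_induct) (simp_all add: pochhammer_int_Suc assms, simp add: pochhammer_int_def)

text \<open>From k to k + 1 the symbol (x)_(-k) loses the factor x - k - 1 while (1 - x)_k gains its
  negative, so their product changes sign only.\<close>

lemma pochhammer_int_minus:
  fixes x :: "'f::field_char_0"
  assumes x: "\<And>n. x + of_int n \<noteq> 0"
  shows "pochhammer_int x (- k) = (- 1) powi k / pochhammer_int (1 - x) k"
proof -
  have y: "1 - x + of_int n \<noteq> 0" for n
    using x[of "- n - 1"] by (auto simp: algebra_simps)
  have "pochhammer_int x (- k) * pochhammer_int (1 - x) k = (- 1) powi k"
  proof (induction k rule: int_iff_induct)
    case (2 k)
    have "pochhammer_int x (- k) = pochhammer_int x (- (k + 1)) * (x - of_int k - 1)"
      using pochhammer_int_Suc[OF x, of "- (k + 1)"] by (simp add: algebra_simps)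
    moreover have "x - of_int k - 1 \<noteq> 0"
      using x[of "- k - 1"] by (simp add: algebra_simps)
    moreover have "pochhammer_int (1 - x) (k + 1) = - pochhammer_int (1 - x) k * (x - of_int k - 1)"
      using pochhammer_int_Suc[OF y, of k] by (simp add: algebra_simps)
    moreover have "(- 1 :: 'f) powi (k + 1) = - ((- 1) powi k)"
      by (simp add: power_int_add)
    ultimately show ?case by (simp add: mult.assoc) (simp add: mult.left_commute mult.commute)
  qed (simp add: pochhammer_int_def)
  then show ?thesis
    using pochhammer_int_nonzero[OF y] by (simp add: eq_divide_eq)
qed


text \<open>The shifted unit-step determinants multiply up to Pochhammer symbols: the factor 1/(a +
  1) accumulates to 1/(a+1)_k, and c - a - 1 from the a-step together with 1/(c - a) from the c-step
  to 1/(c-a)_(m-k).\<close>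

definition contig_det :: "int \<Rightarrow> int \<Rightarrow> int \<Rightarrow> Cabcz" where
  "contig_det k l m =
     (pochhammer_int \<^bold>c m * pochhammer_int \<^bold>c m * \<^bold>z powi (- m) * (\<^bold>z - 1) powi (m - k - l))
     / (pochhammer_int (\<^bold>a + 1) k * pochhammer_int \<^bold>b l
        * pochhammer_int (\<^bold>c - \<^bold>a) (m - k) * pochhammer_int (\<^bold>c - \<^bold>b) (m - l))"

lemma var_a_plus1_nonzero: "\<^bold>a + 1 + of_int n \<noteq> 0"
  using var_nonzero(1)[of "n + 1"] by (simp add: add_ac)

lemma contig_det_0: "contig_det 0 0 0 = 1"
  by (simp add: contig_det_def pochhammer_int_def)

lemma contig_det_step:
  "contig_det (k + 1) l m = contig_det k l m * \<S> k l m ((\<^bold>c - \<^bold>a - 1) / ((\<^bold>a + 1) * (\<^bold>z - 1)))"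
  "contig_det k (l + 1) m = contig_det k l m * \<S> k l m ((\<^bold>c - \<^bold>b - 1) / (\<^bold>b * (\<^bold>z - 1)))"
  "contig_det k l (m + 1) =
    contig_det k l m * \<S> k l m (\<^bold>c\<^sup>2 * (\<^bold>z - 1) / ((\<^bold>c - \<^bold>a) * (\<^bold>c - \<^bold>b) * \<^bold>z))"
proof -
  note S = ring_embeddingD[OF ring_embedding_shift] ring_embedding_diff[OF ring_embedding_shift]
    ring_embedding_divide[OF ring_embedding_shift] shift_vars power2_eq_square
  note nz = var_nonzero(6,8)
  note n1 = pochhammer_int_nonzero[OF var_a_plus1_nonzero] pochhammer_int_nonzero[OF var_nonzero(2)]
    pochhammer_int_nonzero[OF var_nonzero(3)] pochhammer_int_nonzero[OF var_nonzero(4)]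
    pochhammer_int_nonzero[OF var_nonzero(5)]
  \<comment> \<open>Raising k lowers the index m - k, so the symbol at m - k is expressed through
    the one at m - (k + 1).\<close>
  have A: "pochhammer_int (\<^bold>c - \<^bold>a) (m - k) =
      pochhammer_int (\<^bold>c - \<^bold>a) (m - (k + 1)) * (\<^bold>c + of_int m - (\<^bold>a + of_int k) - 1)"
    using pochhammer_int_Suc[OF var_nonzero(4), of "m - (k + 1)"] by (simp add: algebra_simps)
  have A': "(\<^bold>z - 1) powi (m - k - l) = (\<^bold>z - 1) powi (m - (k + 1) - l) * (\<^bold>z - 1)"
  proof -
    have e: "m - k - l = m - (k + 1) - l + 1" by simp
    show ?thesis unfolding e by (rule power_int_add_1) (use nz in simp)
  qed
  have Ak: "\<^bold>a + of_int k + 1 \<noteq> 0" "\<^bold>c + of_int m - (\<^bold>a + of_int k) - 1 \<noteq> 0"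
    using var_a_plus1_nonzero[of k] var_nonzero(4)[of "m - k - 1"] by (simp_all add: algebra_simps)
  show "contig_det (k + 1) l m = contig_det k l m * \<S> k l m ((\<^bold>c - \<^bold>a - 1) / ((\<^bold>a + 1) * (\<^bold>z - 1)))"
    unfolding contig_det_def A A' pochhammer_int_Suc[OF var_a_plus1_nonzero] S
    using nz n1 Ak by (simp add: divide_simps add.assoc[of "\<^bold>a" 1] add.commute[of 1] add.assoc[of "\<^bold>a"])
  have B: "pochhammer_int (\<^bold>c - \<^bold>b) (m - l) =
      pochhammer_int (\<^bold>c - \<^bold>b) (m - (l + 1)) * (\<^bold>c + of_int m - (\<^bold>b + of_int l) - 1)"
    using pochhammer_int_Suc[OF var_nonzero(5), of "m - (l + 1)"] by (simp add: algebra_simps)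
  have B': "(\<^bold>z - 1) powi (m - k - l) = (\<^bold>z - 1) powi (m - k - (l + 1)) * (\<^bold>z - 1)"
  proof -
    have e: "m - k - l = m - k - (l + 1) + 1" by simp
    show ?thesis unfolding e by (rule power_int_add_1) (use nz in simp)
  qed
  have Bk: "\<^bold>b + of_int l \<noteq> 0" "\<^bold>c + of_int m - (\<^bold>b + of_int l) - 1 \<noteq> 0"
    using var_nonzero(2)[of l] var_nonzero(5)[of "m - l - 1"] by (simp_all add: algebra_simps)
  show "contig_det k (l + 1) m = contig_det k l m * \<S> k l m ((\<^bold>c - \<^bold>b - 1) / (\<^bold>b * (\<^bold>z - 1)))"
    unfolding contig_det_def B B' pochhammer_int_Suc[OF var_nonzero(2)] S
    using nz n1 Bk by (simp add: divide_simps)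
  have C: "pochhammer_int (\<^bold>c - \<^bold>a) (m + 1 - k) =
      pochhammer_int (\<^bold>c - \<^bold>a) (m - k) * (\<^bold>c + of_int m - (\<^bold>a + of_int k))"
    "pochhammer_int (\<^bold>c - \<^bold>b) (m + 1 - l) =
      pochhammer_int (\<^bold>c - \<^bold>b) (m - l) * (\<^bold>c + of_int m - (\<^bold>b + of_int l))"
    using pochhammer_int_Suc[OF var_nonzero(4), of "m - k"] pochhammer_int_Suc[OF var_nonzero(5), of "m - l"]
    by (simp_all add: algebra_simps)
  have C': "(\<^bold>z - 1) powi (m + 1 - k - l) = (\<^bold>z - 1) powi (m - k - l) * (\<^bold>z - 1)"
    "\<^bold>z powi (- m) = \<^bold>z powi (- (m + 1)) * \<^bold>z"
    using power_int_add_1[of "\<^bold>z - 1" "m - k - l"] power_int_add_1[of "\<^bold>z" "- (m + 1)"] nz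
    by (simp_all add: algebra_simps)
  have Ck: "\<^bold>c + of_int m - (\<^bold>a + of_int k) \<noteq> 0" "\<^bold>c + of_int m - (\<^bold>b + of_int l) \<noteq> 0"
    using var_nonzero(4)[of "m - k"] var_nonzero(5)[of "m - l"] by (simp_all add: algebra_simps)
  show "contig_det k l (m + 1) =
    contig_det k l m * \<S> k l m (\<^bold>c\<^sup>2 * (\<^bold>z - 1) / ((\<^bold>c - \<^bold>a) * (\<^bold>c - \<^bold>b) * \<^bold>z))"
    unfolding contig_det_def C C' pochhammer_int_Suc[OF var_nonzero(3)] S
    using nz n1 Ck by (simp add: divide_simps)
qed

lemma contig_det_nonzero: "contig_det k l m \<noteq> 0"
  using var_nonzero(6,8) by (simp add: contig_det_def pochhammer_int_nonzero[OF var_a_plus1_nonzero]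
    pochhammer_int_nonzero[OF var_nonzero(2)] pochhammer_int_nonzero[OF var_nonzero(3)]
    pochhammer_int_nonzero[OF var_nonzero(4)] pochhammer_int_nonzero[OF var_nonzero(5)])

lemma contig_det_minus:
  "- contig_det (- k) (- l) (- m) =
     ((- 1) powi (m + 1) * pochhammer_int (- \<^bold>a) k * pochhammer_int (1 - \<^bold>b) l
        * \<^bold>z powi m * (1 - \<^bold>z) powi (k + l - m))
     / (pochhammer_int (1 - \<^bold>c) m * pochhammer_int (1 - \<^bold>c) m
        * pochhammer_int (\<^bold>c - \<^bold>a) (k - m) * pochhammer_int (\<^bold>c - \<^bold>b) (l - m))"
proof -
  define s where "s n = (- 1 :: Cabcz) powi n" for n
  have s: "s n * s n = 1" for n
    unfolding s_def by (simp flip: power_int_mult_distrib)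
  have "s n \<noteq> 0" for n unfolding s_def by simp
  have sm: "s (k + l - m) = s k * s l * s m"
    unfolding s_def by (simp add: power_int_add power_int_diff power_int_minus divide_simps)
  have s1: "(- 1 :: Cabcz) powi (m + 1) = - s m"
    by (simp add: s_def power_int_add)
  have z: "(\<^bold>z - 1) powi (k + l - m) = s (k + l - m) * (1 - \<^bold>z) powi (k + l - m)"
    unfolding s_def by (simp flip: power_int_mult_distrib)
  have mm: "k - m - - l = k + l - m" "- m - - k = k - m" "- m - - l = l - m" "- (- m) = m"
    by simp_all
  have a: "1 - (\<^bold>a + 1) = - \<^bold>a" by simp
  note p = pochhammer_int_minus[OF var_a_plus1_nonzero] pochhammer_int_minus[OF var_nonzero(2)]
    pochhammer_int_minus[OF var_nonzero(3)]
  have "- contig_det (- k) (- l) (- m) =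
    - ((s m / pochhammer_int (1 - \<^bold>c) m) * (s m / pochhammer_int (1 - \<^bold>c) m) * \<^bold>z powi m
        * (s k * s l * s m * (1 - \<^bold>z) powi (k + l - m)))
     / (s k / pochhammer_int (- \<^bold>a) k * (s l / pochhammer_int (1 - \<^bold>b) l)
        * pochhammer_int (\<^bold>c - \<^bold>a) (k - m) * pochhammer_int (\<^bold>c - \<^bold>b) (l - m))"
    unfolding contig_det_def mm p[folded s_def] a z sm by (simp only: minus_divide_left)
  \<comment> \<open>The signs of k and l cancel between numerator and denominator. Three signs of m
    remain, two of which cancel, and the outer minus makes the exponent m + 1.\<close>
  also have "\<dots> = - (s m * (s m * s m)) * pochhammer_int (- \<^bold>a) k * pochhammer_int (1 - \<^bold>b) l
        * \<^bold>z powi m * (1 - \<^bold>z) powi (k + l - m)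
     / (pochhammer_int (1 - \<^bold>c) m * pochhammer_int (1 - \<^bold>c) m
        * pochhammer_int (\<^bold>c - \<^bold>a) (k - m) * pochhammer_int (\<^bold>c - \<^bold>b) (l - m))"
    using \<open>s k \<noteq> 0\<close> \<open>s l \<noteq> 0\<close> by (simp add: mult_ac)
  finally show ?thesis unfolding s s1 by simp
qed

lemma frame_hypF:
  "frame (\<^bold>F 0 0 0) (\<^bold>F 1 0 0) (\<^bold>F k l m) (\<^bold>F (k + 1) l m) (contig_det k l m)"
proof -
  define R where "R k l m \<longleftrightarrow> frame (\<^bold>F 0 0 0) (\<^bold>F 1 0 0) (\<^bold>F k l m) (\<^bold>F (k + 1) l m) (contig_det k l m)"
    for k l m
  have step: "R (k + i) (l + j) (m + n) \<longleftrightarrow> R k l m"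
    if w: "frame (\<^bold>F 0 0 0) (\<^bold>F 1 0 0) (\<^bold>F i j n) (\<^bold>F (i + 1) j n) w"
      and det: "contig_det (k + i) (l + j) (m + n) = contig_det k l m * \<S> k l m w" for i j n k l m w
  proof -
    \<comment> \<open>The closed form never vanishes, hence neither does its factor, the shifted
      step determinant; this allows the step to be undone.\<close>
    have nz: "\<S> k l m w \<noteq> 0" using det contig_det_nonzero[of "k + i" "l + j" "m + n"] by auto
    note f = frame_shift[OF w, of k l m]
    show ?thesis
    proof
      show "R k l m \<Longrightarrow> R (k + i) (l + j) (m + n)"
        unfolding R_def det using frame_trans f by blast
      assume "R (k + i) (l + j) (m + n)"
      then have "frame (\<^bold>F 0 0 0) (\<^bold>F 1 0 0) (\<^bold>F k l m) (\<^bold>F (k + 1) l m)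
          (contig_det k l m * \<S> k l m w * (1 / \<S> k l m w))"
        unfolding R_def det using frame_trans frame_inv[OF f nz] by blast
      then show "R k l m" unfolding R_def using nz by simp
    qed
  qed
  have "R 0 0 (k + 1) \<longleftrightarrow> R 0 0 k" for k
    using step[where i = 0 and j = 0 and n = 1 and k = 0 and l = 0 and m = k]
      contig_det_step(3)[of 0 0 k] frame_step(3) by simp
  moreover have "R 0 0 0"
    by (simp add: R_def contig_det_0 frame_refl)
  ultimately have m: "R 0 0 m"
    by (induction m rule: int_iff_induct) simp_all
  have "R 0 (k + 1) m \<longleftrightarrow> R 0 k m" for k
    using step[where i = 0 and j = 1 and n = 0 and k = 0 and l = k and m = m]
      contig_det_step(2)[of 0 k m] frame_step(2) by simp
  with m have l: "R 0 l m"
    by (induction l rule: int_iff_induct) simp_all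
  have "R (k + 1) l m \<longleftrightarrow> R k l m" for k
    using step[where i = 1 and j = 0 and n = 0 and k = k and l = l and m = m]
      contig_det_step(1)[of k l m] frame_step(1) by simp
  with l have "R k l m"
    by (induction k rule: int_iff_induct) simp_all
  then show ?thesis unfolding R_def .
qed

section \<open>Uniqueness of the coefficients and the identities for P and Q\<close>

lemma hypF_unique:
  assumes "laurent p * \<^bold>F 0 0 0 + laurent q * \<^bold>F 1 0 0 = laurent p' * \<^bold>F 0 0 0 + laurent q' * \<^bold>F 1 0 0"
  shows "p = p' \<and> q = q'"
proof -
  have "laurent (p - p') * \<^bold>F 0 0 0 + laurent (q - q') * \<^bold>F 1 0 0 = 0"
    unfolding ring_embedding_diff[OF ring_embedding_laurent] using assms by algebra
  then show ?thesis using hypF_independent by fastforce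
qed

lemma hypF_ex1:
  "\<exists>!PQ :: Cabcz \<times> Cabcz. \<^bold>F k l m = laurent (fst PQ) * \<^bold>F 0 0 0 + laurent (snd PQ) * \<^bold>F 1 0 0"
proof -
  obtain p q where "\<^bold>F k l m = laurent p * \<^bold>F 0 0 0 + laurent q * \<^bold>F 1 0 0"
    using frame_hypF[of k l m] unfolding frame_def by blast
  then show ?thesis
    by (intro ex1I[of _ "(p, q)"]) (auto dest: hypF_unique simp: prod_eq_iff)
qed

context
  fixes P Q :: "int \<Rightarrow> int \<Rightarrow> int \<Rightarrow> Cabcz"
  assumes PQ: "\<And>k l m. \<^bold>F k l m = laurent (P k l m) * \<^bold>F 0 0 0 + laurent (Q k l m) * \<^bold>F 1 0 0"
begin

lemma PQ_eqI:
  assumes "\<^bold>F k l m = laurent p * \<^bold>F 0 0 0 + laurent q * \<^bold>F 1 0 0"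
  shows "P k l m = p" "Q k l m = q"
  using hypF_unique[of "P k l m" "Q k l m" p q] PQ[of k l m] assms by metis+

lemma PQ_initial: "P 0 0 0 = 1" "Q 0 0 0 = 0" "P 1 0 0 = 0" "Q 1 0 0 = 1"
  using PQ_eqI[of 0 0 0 1 0] PQ_eqI[of 1 0 0 0 1] by (simp_all add: ring_embeddingD[OF ring_embedding_laurent])

lemma PQ_relation:
  fixes f :: "'i \<Rightarrow> Cabcz"
  assumes "(\<Sum>n\<in>I. laurent (f n) * \<^bold>F (\<alpha> n) (\<beta> n) (\<gamma> n)) = 0"
  shows "(\<Sum>n\<in>I. \<S> k l m (f n) * P (k + \<alpha> n) (l + \<beta> n) (m + \<gamma> n)) = 0"
    and "(\<Sum>n\<in>I. \<S> k l m (f n) * Q (k + \<alpha> n) (l + \<beta> n) (m + \<gamma> n)) = 0"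
proof -
  note L = ring_embeddingD[OF ring_embedding_laurent] ring_embedding_sum[OF ring_embedding_laurent]
  have "(\<Sum>n\<in>I. laurent (\<S> k l m (f n)) * \<^bold>F (k + \<alpha> n) (l + \<beta> n) (m + \<gamma> n)) = 0"
    unfolding relation_shift by (rule assms)
  moreover have "(\<Sum>n\<in>I. laurent (\<S> k l m (f n)) * \<^bold>F (k + \<alpha> n) (l + \<beta> n) (m + \<gamma> n)) =
      laurent (\<Sum>n\<in>I. \<S> k l m (f n) * P (k + \<alpha> n) (l + \<beta> n) (m + \<gamma> n)) * \<^bold>F 0 0 0
      + laurent (\<Sum>n\<in>I. \<S> k l m (f n) * Q (k + \<alpha> n) (l + \<beta> n) (m + \<gamma> n)) * \<^bold>F 1 0 0"
    unfolding L sum_distrib_right sum.distrib[symmetric]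
  proof (rule sum.cong[OF refl])
    fix n
    have "s * F = s * p * F0 + s * q * F1" if "F = p * F0 + q * F1" for s p q F F0 F1 :: "Cabc fls"
      using that by (simp add: distrib_left mult.assoc)
    from this[OF PQ]
    show "laurent (\<S> k l m (f n)) * \<^bold>F (k + \<alpha> n) (l + \<beta> n) (m + \<gamma> n) =
      laurent (\<S> k l m (f n)) * laurent (P (k + \<alpha> n) (l + \<beta> n) (m + \<gamma> n)) * \<^bold>F 0 0 0
      + laurent (\<S> k l m (f n)) * laurent (Q (k + \<alpha> n) (l + \<beta> n) (m + \<gamma> n)) * \<^bold>F 1 0 0" .
  qed
  ultimately show "(\<Sum>n\<in>I. \<S> k l m (f n) * P (k + \<alpha> n) (l + \<beta> n) (m + \<gamma> n)) = 0"
    and "(\<Sum>n\<in>I. \<S> k l m (f n) * Q (k + \<alpha> n) (l + \<beta> n) (m + \<gamma> n)) = 0"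
    using hypF_independent by simp_all
qed

lemma PQ_compose:
  "P (k + k') (l + l') (m + m') =
     \<S> k l m (P k' l' m') * P k l m + \<S> k l m (Q k' l' m') * P (k + 1) l m"
  "Q (k + k') (l + l') (m + m') =
     \<S> k l m (P k' l' m') * Q k l m + \<S> k l m (Q k' l' m') * Q (k + 1) l m"
proof -
  have "\<^bold>F (k + k') (l + l') (m + m') =
    laurent (\<S> k l m (P k' l' m')) * \<^bold>F k l m + laurent (\<S> k l m (Q k' l' m')) * \<^bold>F (k + 1) l m"
    using hypF_shift[OF PQ, of k k' l l' m m'] by simp
  also have "\<dots> = laurent (\<S> k l m (P k' l' m') * P k l m + \<S> k l m (Q k' l' m') * P (k + 1) l m) * \<^bold>F 0 0 0
    + laurent (\<S> k l m (P k' l' m') * Q k l m + \<S> k l m (Q k' l' m') * Q (k + 1) l m) * \<^bold>F 1 0 0"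
    unfolding PQ[of k l m] PQ[of "k + 1" l m] ring_embeddingD[OF ring_embedding_laurent] by algebra
  finally show "P (k + k') (l + l') (m + m') =
     \<S> k l m (P k' l' m') * P k l m + \<S> k l m (Q k' l' m') * P (k + 1) l m"
    "Q (k + k') (l + l') (m + m') =
     \<S> k l m (P k' l' m') * Q k l m + \<S> k l m (Q k' l' m') * Q (k + 1) l m"
    by (rule PQ_eqI)+
qed

lemma P_2: "P 2 0 0 = (\<^bold>c - \<^bold>a - 1) / ((\<^bold>a + 1) * (1 - \<^bold>z))"
  by (rule PQ_eqI(1)[OF laurent_solve[OF hypF_contiguous(1)]])
    (use var_nonzero(7) var_a_plus1_nonzero[of 0] in simp)

text \<open>The cocycle identity is split off at the unit step in a: there P(1,0,0) = 0 removes one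
  term, and P(2,0,0) is the stated prefactor.\<close>

lemma P_eq_Q: "P k l m = (\<^bold>c - \<^bold>a - 1) / ((\<^bold>a + 1) * (1 - \<^bold>z)) * S\<^sub>a (Q (k - 1) l m)"
  using PQ_compose(1)[of 1 "k - 1" 0 l 0 m] by (simp add: PQ_initial P_2 shift_100)

lemma P_eq_shift: "P k l m = S\<^sub>a ((\<^bold>c - \<^bold>a) / (\<^bold>a * (1 - \<^bold>z)) * Q (k - 1) l m)"
  unfolding P_eq_Q using ring_embedding_shifts(1)
  by (simp add: ring_embeddingD[OF ring_embedding_shifts(1)] ring_embedding_divide ring_embedding_diff
      shift_variables diff_diff_eq)

lemma Q_add:
  "Q (k + k') (l + l') (m + m') =
     \<S> k l m (Q k' l' m') * Q (k + 1) l m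
     + \<S> (k + 1) l m ((\<^bold>c - \<^bold>a) / (\<^bold>a * (1 - \<^bold>z)) * Q (k' - 1) l' m') * Q k l m"
  unfolding PQ_compose(2) P_eq_shift[of k' l' m'] shift_shift_a by (rule add.commute)

text \<open>By uniqueness the anonymous matrix inside \<open>frame\<close> has the entries
  \<open>P\<close> and \<open>Q\<close>, so its recorded determinant is this one.\<close>

lemma PQ_det_succ: "P k l m * Q (k + 1) l m - P (k + 1) l m * Q k l m = contig_det k l m"
proof -
  obtain p1 q1 p2 q2 where 1: "\<^bold>F k l m = laurent p1 * \<^bold>F 0 0 0 + laurent q1 * \<^bold>F 1 0 0"
    "\<^bold>F (k + 1) l m = laurent p2 * \<^bold>F 0 0 0 + laurent q2 * \<^bold>F 1 0 0"
    "p1 * q2 - p2 * q1 = contig_det k l m"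
    using frame_hypF[of k l m] unfolding frame_def by blast
  show ?thesis
    unfolding PQ_eqI[OF 1(1)] PQ_eqI[OF 1(2)] by (rule 1(3))
qed

text \<open>By the cocycle identity the column at (k', l', m') combines those at (k, l, m) and (k +
  1, l, m). The part along (k, l, m) drops out of the determinant.\<close>

lemma PQ_det:
  "P k l m * Q k' l' m' - P k' l' m' * Q k l m =
     contig_det k l m * \<S> k l m (Q (k' - k) (l' - l) (m' - m))"
  using PQ_compose[of k "k' - k" l "l' - l" m "m' - m"] PQ_det_succ[of k l m]
  by simp algebra

text \<open>This is the determinant formula between (-k, -l, -m) and the origin, where the column is
  (1, 0).\<close>

lemma Q_minus: "Q (- k) (- l) (- m) = - contig_det (- k) (- l) (- m) * \<S> (- k) (- l) (- m) (Q k l m)"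
proof -
  have "- Q (- k) (- l) (- m) = contig_det (- k) (- l) (- m) * \<S> (- k) (- l) (- m) (Q k l m)"
    using PQ_det[of "- k" "- l" "- m" 0 0 0] by (simp add: PQ_initial)
  then show ?thesis by (metis mult_minus_left minus_minus)
qed

end

theorem theorem1p1:
  shows
  "(\<forall>k l m :: int. \<exists>!PQ :: Cabcz \<times> Cabcz.
      \<^bold>F k l m = laurent (fst PQ) * \<^bold>F 0 0 0 + laurent (snd PQ) * \<^bold>F 1 0 0)
   \<and>
   (\<forall>P Q :: int \<Rightarrow> int \<Rightarrow> int \<Rightarrow> Cabcz.
      (\<forall>k l m. \<^bold>F k l m = laurent (P k l m) * \<^bold>F 0 0 0 + laurent (Q k l m) * \<^bold>F 1 0 0)
      \<longrightarrow>
      (\<forall>(\<alpha> :: nat \<Rightarrow> int) (\<beta> :: nat \<Rightarrow> int) (\<gamma> :: nat \<Rightarrow> int) (f :: nat \<Rightarrow> Cabcz).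
         (\<Sum>n=1..3. laurent (f n) * \<^bold>F (\<alpha> n) (\<beta> n) (\<gamma> n)) = 0 \<longrightarrow>
         (\<forall>k l m.
            (\<Sum>n=1..3. \<S> k l m (f n) * P (k + \<alpha> n) (l + \<beta> n) (m + \<gamma> n)) = 0 \<and>
            (\<Sum>n=1..3. \<S> k l m (f n) * Q (k + \<alpha> n) (l + \<beta> n) (m + \<gamma> n)) = 0))
      \<and>
      (P 0 0 0 = 1 \<and> Q 0 0 0 = 0 \<and> P 1 0 0 = 0 \<and> Q 1 0 0 = 1)
      \<and>
      (\<forall>k l m.
         P k l m = (\<^bold>c - \<^bold>a - 1) / ((\<^bold>a + 1) * (1 - \<^bold>z)) * S\<^sub>a (Q (k - 1) l m))
      \<and>
      (\<forall>k l m k' l' m'.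
         Q (k + k') (l + l') (m + m') =
           \<S> k l m (Q k' l' m') * Q (k + 1) l m
           + \<S> (k + 1) l m ((\<^bold>c - \<^bold>a) / (\<^bold>a * (1 - \<^bold>z)) * Q (k' - 1) l' m') * Q k l m)
      \<and>
      (\<forall>k l m k' l' m'.
         P k l m * Q k' l' m' - P k' l' m' * Q k l m =
           (pochhammer_int \<^bold>c m * pochhammer_int \<^bold>c m
              * \<^bold>z powi (- m) * (\<^bold>z - 1) powi (m - k - l))
           / (pochhammer_int (\<^bold>a + 1) k * pochhammer_int \<^bold>b l
              * pochhammer_int (\<^bold>c - \<^bold>a) (m - k) * pochhammer_int (\<^bold>c - \<^bold>b) (m - l))
           * \<S> k l m (Q (k' - k) (l' - l) (m' - m)))
      \<and>
      (\<forall>k l m.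
         Q (- k) (- l) (- m) =
           ((- 1) powi (m + 1) * pochhammer_int (- \<^bold>a) k * pochhammer_int (1 - \<^bold>b) l
              * \<^bold>z powi m * (1 - \<^bold>z) powi (k + l - m))
           / (pochhammer_int (1 - \<^bold>c) m * pochhammer_int (1 - \<^bold>c) m
              * pochhammer_int (\<^bold>c - \<^bold>a) (k - m) * pochhammer_int (\<^bold>c - \<^bold>b) (l - m))
           * \<S> (- k) (- l) (- m) (Q k l m)))"
proof (intro conjI allI impI)
  fix k l m :: int
  show "\<exists>!PQ :: Cabcz \<times> Cabcz.
      \<^bold>F k l m = laurent (fst PQ) * \<^bold>F 0 0 0 + laurent (snd PQ) * \<^bold>F 1 0 0"
    by (rule hypF_ex1)
next
  fix P Q :: "int \<Rightarrow> int \<Rightarrow> int \<Rightarrow> Cabcz"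
  assume *: "\<forall>k l m. \<^bold>F k l m = laurent (P k l m) * \<^bold>F 0 0 0 + laurent (Q k l m) * \<^bold>F 1 0 0"
  then have PQ: "\<And>k l m. \<^bold>F k l m = laurent (P k l m) * \<^bold>F 0 0 0 + laurent (Q k l m) * \<^bold>F 1 0 0"
    by blast
  show "P 0 0 0 = 1" "Q 0 0 0 = 0" "P 1 0 0 = 0" "Q 1 0 0 = 1"
    by (rule PQ_initial[OF PQ])+
  fix k l m :: int
  show "P k l m = (\<^bold>c - \<^bold>a - 1) / ((\<^bold>a + 1) * (1 - \<^bold>z)) * S\<^sub>a (Q (k - 1) l m)"
    by (rule P_eq_Q[OF PQ])
  show "Q (- k) (- l) (- m) =
      ((- 1) powi (m + 1) * pochhammer_int (- \<^bold>a) k * pochhammer_int (1 - \<^bold>b) l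
         * \<^bold>z powi m * (1 - \<^bold>z) powi (k + l - m))
      / (pochhammer_int (1 - \<^bold>c) m * pochhammer_int (1 - \<^bold>c) m
         * pochhammer_int (\<^bold>c - \<^bold>a) (k - m) * pochhammer_int (\<^bold>c - \<^bold>b) (l - m))
      * \<S> (- k) (- l) (- m) (Q k l m)"
    by (rule Q_minus[OF PQ, unfolded contig_det_minus])
  {
    fix \<alpha> \<beta> \<gamma> :: "nat \<Rightarrow> int" and f :: "nat \<Rightarrow> Cabcz"
    assume "(\<Sum>n=1..3. laurent (f n) * \<^bold>F (\<alpha> n) (\<beta> n) (\<gamma> n)) = 0"
    then show "(\<Sum>n=1..3. \<S> k l m (f n) * P (k + \<alpha> n) (l + \<beta> n) (m + \<gamma> n)) = 0"
      and "(\<Sum>n=1..3. \<S> k l m (f n) * Q (k + \<alpha> n) (l + \<beta> n) (m + \<gamma> n)) = 0"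
      by (rule PQ_relation[OF PQ])+
  }
  fix k' l' m' :: int
  show "Q (k + k') (l + l') (m + m') =
      \<S> k l m (Q k' l' m') * Q (k + 1) l m
      + \<S> (k + 1) l m ((\<^bold>c - \<^bold>a) / (\<^bold>a * (1 - \<^bold>z)) * Q (k' - 1) l' m') * Q k l m"
    by (rule Q_add[OF PQ])
  show "P k l m * Q k' l' m' - P k' l' m' * Q k l m =
      (pochhammer_int \<^bold>c m * pochhammer_int \<^bold>c m
         * \<^bold>z powi (- m) * (\<^bold>z - 1) powi (m - k - l))
      / (pochhammer_int (\<^bold>a + 1) k * pochhammer_int \<^bold>b l
         * pochhammer_int (\<^bold>c - \<^bold>a) (m - k) * pochhammer_int (\<^bold>c - \<^bold>b) (m - l))
      * \<S> k l m (Q (k' - k) (l' - l) (m' - m))"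
    by (rule PQ_det[OF PQ, unfolded contig_det_def])
qed

end
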